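(* Let $R$ be an $A$-algebra, let $x=x_1,\dots,x_n$ be an $n$-tuple of elements in $R$, and let $P=A[\mathfrak p(z)]_{z\in R}\subseteq\mathrm{TS}^n_AR$ be the $A$-subalgebra generated by the polarized power sums $\mathfrak p(z)$, $z\in R$. Then the inclusion of $A$-algebras $P\subseteq\mathrm{TS}^n_AR$ becomes an isomorphism after localization with respect to $\alpha^2(x)$.
   Context: All rings are commutative with unit; $n\ge1$. $\mathrm T^n_AR=R\otimes_A\cdots\otimes_AR$ ($n$ factors), $\varphi_p:R\to\mathrm T^n_AR$ is the co-projection on the $p$-th factor, and $\mathrm{TS}^n_AR=(\mathrm T^n_AR)^{\mathfrak S_n}$ is the ring of invariants of the symmetric group permuting the factors. The polarized power sum of $z\in R$ is $\mathfrak p(z)=\varphi_1(z)+\cdots+\varphi_n(z)\in\mathrm{TS}^n_AR$. The alternating tensor is $\alpha(x)=\sum_{\sigma\in\mathfrak S_n}(-1)^{|\sigma|}x_{\sigma(1)}\otimes\cdots\otimes x_{\sigma(n)}$; its square $\alpha^2(x)$ lies in $\mathrm{TS}^n_AR$. One has $\alpha^2(x)=\det(\mathfrak p(x_ix_j))_{i,j}$, so that $\alpha^2(x)\in P$. *)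

theory Defs
  imports "HOL-Library.Poly_Mapping" "HOL-Combinatorics.Permutations"
    "HOL-Algebra.Module" "HOL-Algebra.Subrings" "HOL-Algebra.Generated_Groups"
begin

section \<open>Tensor powers of an algebra\<close>

text \<open>
  The \<open>n\<close> tensor factors are indexed by \<open>{..<n}\<close>. An \<open>n\<close>-tuple of elements of \<open>R\<close> is an
  extensional function on \<open>{..<n}\<close>, and \<open>\<int>[R\<^sup>n]\<close> is the ring of formal integral
  combinations of such tuples, multiplied by extending the componentwise product bilinearly.
\<close>

definition tuples :: "('b, 'm) ring_scheme \<Rightarrow> nat \<Rightarrow> (nat \<Rightarrow> 'b) set"
  where "tuples R n = ({..<n} \<rightarrow>\<^sub>E carrier R)"

definition tuple_mult ::
    "('b, 'm) ring_scheme \<Rightarrow> nat \<Rightarrow> (nat \<Rightarrow> 'b) \<Rightarrow> (nat \<Rightarrow> 'b) \<Rightarrow> (nat \<Rightarrow> 'b)"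
  where "tuple_mult R n x y = (\<lambda>i\<in>{..<n}. x i \<otimes>\<^bsub>R\<^esub> y i)"

definition tuple_ring :: "('b, 'm) ring_scheme \<Rightarrow> nat \<Rightarrow> ((nat \<Rightarrow> 'b) \<Rightarrow>\<^sub>0 int) ring"
  where "tuple_ring R n =
    \<lparr>carrier = {c. Poly_Mapping.keys c \<subseteq> tuples R n},
     mult = (\<lambda>c d. frag_extend (\<lambda>x. frag_extend (\<lambda>y. frag_of (tuple_mult R n x y)) d) c),
     one = frag_of (\<lambda>i\<in>{..<n}. \<one>\<^bsub>R\<^esub>),
     zero = 0,
     add = (+)\<rparr>"

text \<open>
  The subgroup of \<open>\<int>[R\<^sup>n]\<close> generated by the relations of additivity in each factor and
  of moving a scalar of \<open>A\<close> from one factor to another; it is an ideal.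
\<close>

definition tensor_rels ::
    "('a, 'k) ring_scheme \<Rightarrow> ('a, 'b, 'm) module_scheme \<Rightarrow> nat \<Rightarrow> ((nat \<Rightarrow> 'b) \<Rightarrow>\<^sub>0 int) set"
  where "tensor_rels A R n =
    {frag_of (x(i := u \<oplus>\<^bsub>R\<^esub> v)) - frag_of (x(i := u)) - frag_of (x(i := v)) | x i u v.
       x \<in> tuples R n \<and> i < n \<and> u \<in> carrier R \<and> v \<in> carrier R} \<union>
    {frag_of (x(i := a \<odot>\<^bsub>R\<^esub> x i)) - frag_of (x(j := a \<odot>\<^bsub>R\<^esub> x j)) | x i j a.
       x \<in> tuples R n \<and> i < n \<and> j < n \<and> a \<in> carrier A}"

definition tensor_ideal ::
    "('a, 'k) ring_scheme \<Rightarrow> ('a, 'b, 'm) module_scheme \<Rightarrow> nat \<Rightarrow> ((nat \<Rightarrow> 'b) \<Rightarrow>\<^sub>0 int) set"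
  where "tensor_ideal A R n = generate (add_monoid (tuple_ring R n)) (tensor_rels A R n)"

text \<open>The pure tensor \<open>x\<^sub>0 \<otimes> \<dots> \<otimes> x\<^sub>n\<^sub>-\<^sub>1\<close>; only the values of \<open>x\<close> below \<open>n\<close> matter.\<close>

definition pure_tensor ::
    "('a, 'k) ring_scheme \<Rightarrow> ('a, 'b, 'm) module_scheme \<Rightarrow> nat \<Rightarrow> (nat \<Rightarrow> 'b) \<Rightarrow>
     ((nat \<Rightarrow> 'b) \<Rightarrow>\<^sub>0 int) set"
  where "pure_tensor A R n x =
    tensor_ideal A R n +>\<^bsub>tuple_ring R n\<^esub> frag_of (restrict x {..<n})"

definition coproj ::
    "('a, 'k) ring_scheme \<Rightarrow> ('a, 'b, 'm) module_scheme \<Rightarrow> nat \<Rightarrow> nat \<Rightarrow> 'b \<Rightarrow>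
     ((nat \<Rightarrow> 'b) \<Rightarrow>\<^sub>0 int) set"
  where "coproj A R n p z = pure_tensor A R n (\<lambda>i. if i = p then z else \<one>\<^bsub>R\<^esub>)"

text \<open>
  For \<open>n \<ge> 1\<close> this is the \<open>n\<close>-fold tensor product of \<open>R\<close> over \<open>A\<close>. A scalar \<open>a\<close> acts as
  multiplication by \<open>(a \<odot> 1) \<otimes> 1 \<otimes> \<dots> \<otimes> 1\<close>, that is, through any one of the factors.
\<close>

definition tensor_power ::
    "('a, 'k) ring_scheme \<Rightarrow> ('a, 'b, 'm) module_scheme \<Rightarrow> nat \<Rightarrow>
     ('a, ((nat \<Rightarrow> 'b) \<Rightarrow>\<^sub>0 int) set) module"
  where "tensor_power A R n = (let T = tuple_ring R n Quot tensor_ideal A R n in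
    \<lparr>carrier = carrier T, mult = mult T,
     one = one T, zero = zero T, add = add T,
     smult = (\<lambda>a t. coproj A R n 0 (a \<odot>\<^bsub>R\<^esub> \<one>\<^bsub>R\<^esub>) \<otimes>\<^bsub>T\<^esub> t)\<rparr>)"

text \<open>
  Permutation of the factors, \<open>x\<^sub>0 \<otimes> \<dots> \<otimes> x\<^sub>n\<^sub>-\<^sub>1 \<mapsto> x\<^sub>\<sigma>\<^sub>0 \<otimes> \<dots> \<otimes> x\<^sub>\<sigma>\<^sub>(\<^sub>n\<^sub>-\<^sub>1\<^sub>)\<close>, applied
  elementwise to a coset of the tensor ideal.
\<close>

definition permute_factors ::
    "(nat \<Rightarrow> nat) \<Rightarrow> ((nat \<Rightarrow> 'b) \<Rightarrow>\<^sub>0 int) set \<Rightarrow> ((nat \<Rightarrow> 'b) \<Rightarrow>\<^sub>0 int) set"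
  where "permute_factors \<sigma> t = frag_extend (\<lambda>x. frag_of (x \<circ> \<sigma>)) ` t"

definition sym_tensors ::
    "('a, 'k) ring_scheme \<Rightarrow> ('a, 'b, 'm) module_scheme \<Rightarrow> nat \<Rightarrow>
     ('a, ((nat \<Rightarrow> 'b) \<Rightarrow>\<^sub>0 int) set) module"
  where "sym_tensors A R n = (tensor_power A R n)
    \<lparr>carrier := {t \<in> carrier (tensor_power A R n).
       \<forall>\<sigma>. \<sigma> permutes {..<n} \<longrightarrow> permute_factors \<sigma> t = t}\<rparr>"

definition power_sum ::
    "('a, 'k) ring_scheme \<Rightarrow> ('a, 'b, 'm) module_scheme \<Rightarrow> nat \<Rightarrow> 'b \<Rightarrow>
     ((nat \<Rightarrow> 'b) \<Rightarrow>\<^sub>0 int) set"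
  where "power_sum A R n z = (\<Oplus>\<^bsub>tensor_power A R n\<^esub>p\<in>{..<n}. coproj A R n p z)"

definition alt_tensor ::
    "('a, 'k) ring_scheme \<Rightarrow> ('a, 'b, 'm) module_scheme \<Rightarrow> nat \<Rightarrow> (nat \<Rightarrow> 'b) \<Rightarrow>
     ((nat \<Rightarrow> 'b) \<Rightarrow>\<^sub>0 int) set"
  where "alt_tensor A R n x =
    (\<Oplus>\<^bsub>tensor_power A R n\<^esub>\<sigma>\<in>{\<sigma>. \<sigma> permutes {..<n}}.
       [sign \<sigma>] \<cdot>\<^bsub>tensor_power A R n\<^esub> pure_tensor A R n (\<lambda>i. x (\<sigma> i)))"

definition alt_tensor_sq ::
    "('a, 'k) ring_scheme \<Rightarrow> ('a, 'b, 'm) module_scheme \<Rightarrow> nat \<Rightarrow> (nat \<Rightarrow> 'b) \<Rightarrow>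
     ((nat \<Rightarrow> 'b) \<Rightarrow>\<^sub>0 int) set"
  where "alt_tensor_sq A R n x = alt_tensor A R n x \<otimes>\<^bsub>tensor_power A R n\<^esub> alt_tensor A R n x"


section \<open>Subalgebras and isomorphisms of algebras\<close>

definition is_subalgebra :: "('a, 'k) ring_scheme \<Rightarrow> ('a, 'b, 'm) module_scheme \<Rightarrow> 'b set \<Rightarrow> bool"
  where "is_subalgebra A M B \<longleftrightarrow>
    subring B M \<and> (\<forall>a\<in>carrier A. \<forall>b\<in>B. a \<odot>\<^bsub>M\<^esub> b \<in> B)"

definition generated_subalgebra ::
    "('a, 'k) ring_scheme \<Rightarrow> ('a, 'b, 'm) module_scheme \<Rightarrow> 'b set \<Rightarrow> ('a, 'b, 'm) module_scheme"
  where "generated_subalgebra A M X = M\<lparr>carrier := \<Inter>{B. is_subalgebra A M B \<and> X \<subseteq> B}\<rparr>"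

definition power_sum_algebra ::
    "('a, 'k) ring_scheme \<Rightarrow> ('a, 'b, 'm) module_scheme \<Rightarrow> nat \<Rightarrow>
     ('a, ((nat \<Rightarrow> 'b) \<Rightarrow>\<^sub>0 int) set) module"
  where "power_sum_algebra A R n =
    generated_subalgebra A (sym_tensors A R n) (power_sum A R n ` carrier R)"

definition algebra_iso ::
    "('a, 'k) ring_scheme \<Rightarrow> ('a, 'b, 'm) module_scheme \<Rightarrow> ('a, 'c, 'l) module_scheme \<Rightarrow> ('b \<Rightarrow> 'c) set"
  where "algebra_iso A M N =
    {h \<in> ring_iso M N. \<forall>a\<in>carrier A. \<forall>x\<in>carrier M. h (a \<odot>\<^bsub>M\<^esub> x) = a \<odot>\<^bsub>N\<^esub> h x}"


section \<open>Localization at an element\<close>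

definition powers :: "('b, 'm) monoid_scheme \<Rightarrow> 'b \<Rightarrow> 'b set"
  where "powers M f = range (\<lambda>k::nat. f [^]\<^bsub>M\<^esub> k)"

text \<open>Pairs \<open>(x, s)\<close> stand for fractions \<open>x / s\<close> whose denominator is a power of \<open>f\<close>.\<close>

definition frac_rel :: "('b, 'm) ring_scheme \<Rightarrow> 'b \<Rightarrow> (('b \<times> 'b) \<times> ('b \<times> 'b)) set"
  where "frac_rel M f =
    {((x, s), (y, t)). x \<in> carrier M \<and> s \<in> powers M f \<and> y \<in> carrier M \<and> t \<in> powers M f \<and>
       (\<exists>u\<in>powers M f. u \<otimes>\<^bsub>M\<^esub> (x \<otimes>\<^bsub>M\<^esub> t) = u \<otimes>\<^bsub>M\<^esub> (y \<otimes>\<^bsub>M\<^esub> s))}"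

definition localization :: "('a, 'b, 'm) module_scheme \<Rightarrow> 'b \<Rightarrow> ('a, ('b \<times> 'b) set) module"
  where "localization M f =
    \<lparr>carrier = (carrier M \<times> powers M f) // frac_rel M f,
     mult = (\<lambda>X Y. \<Union>(x, s)\<in>X. \<Union>(y, t)\<in>Y. frac_rel M f `` {(x \<otimes>\<^bsub>M\<^esub> y, s \<otimes>\<^bsub>M\<^esub> t)}),
     one = frac_rel M f `` {(\<one>\<^bsub>M\<^esub>, \<one>\<^bsub>M\<^esub>)},
     zero = frac_rel M f `` {(\<zero>\<^bsub>M\<^esub>, \<one>\<^bsub>M\<^esub>)},
     add = (\<lambda>X Y. \<Union>(x, s)\<in>X. \<Union>(y, t)\<in>Y.
              frac_rel M f `` {(x \<otimes>\<^bsub>M\<^esub> t \<oplus>\<^bsub>M\<^esub> y \<otimes>\<^bsub>M\<^esub> s, s \<otimes>\<^bsub>M\<^esub> t)}),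
     smult = (\<lambda>a X. \<Union>(x, s)\<in>X. frac_rel M f `` {(a \<odot>\<^bsub>M\<^esub> x, s)})\<rparr>"

text \<open>The map \<open>x / s \<mapsto> h x / h s\<close> induced by \<open>h\<close> on the localizations at \<open>f\<close> and \<open>h f\<close>.\<close>

definition localization_map ::
    "('b \<Rightarrow> 'c) \<Rightarrow> ('a, 'c, 'l) module_scheme \<Rightarrow> 'b \<Rightarrow> ('b \<times> 'b) set \<Rightarrow> ('c \<times> 'c) set"
  where "localization_map h N f X = (\<Union>(x, s)\<in>X. frac_rel N (h f) `` {(h x, h s)})"

end

theory Submission
  imports Defs
begin

text \<open>
  Let \<open>Alt(u) = \<Sum>\<sigma>. sgn(\<sigma>) \<sigma>(u)\<close> be the antisymmetrization of a tensor \<open>u\<close>, so that \<open>\<alpha>(x)\<close> is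
  the antisymmetrization of the pure tensor \<open>x\<^sub>1 \<otimes> \<dots> \<otimes> x\<^sub>n\<close>. If \<open>t\<close> is symmetric, then
  \<open>Alt(u) t = Alt(u t)\<close>, hence \<open>\<alpha>\<^sup>2(x) t = \<alpha>(x) Alt((x\<^sub>1 \<otimes> \<dots> \<otimes> x\<^sub>n) t)\<close>. Expanding
  \<open>(x\<^sub>1 \<otimes> \<dots> \<otimes> x\<^sub>n) t\<close> into pure tensors \<open>y\<^sub>1 \<otimes> \<dots> \<otimes> y\<^sub>n\<close> writes this as a sum of products
  \<open>\<alpha>(x) \<alpha>(y)\<close>. Since \<open>\<alpha>(x) = det(\<phi>\<^sub>p(x\<^sub>i))\<close>, such a product is the determinant of the matrix
  \<open>\<Sum>p. \<phi>\<^sub>p(x\<^sub>i) \<phi>\<^sub>p(y\<^sub>j) = \<pp>(x\<^sub>i y\<^sub>j)\<close> of power sums and lies in \<open>P\<close>. Thus \<open>\<alpha>\<^sup>2(x)\<close> multiplies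
  all symmetric tensors into \<open>P\<close>, and inverting it identifies the two algebras.
\<close>

section \<open>Finite sums and products\<close>

lemma (in comm_monoid) finprod_in_submonoid:
  assumes H: "submonoid H G" and "f \<in> A \<rightarrow> H"
  shows "(\<Otimes>a\<in>A. f a) \<in> H"
  using assms(2)
proof (induction A rule: infinite_finite_induct)
  case (insert a A)
  then have "f \<in> A \<rightarrow> carrier G" "f a \<in> carrier G"
    using submonoid.subset[OF H] by auto
  then show ?case using insert submonoid.m_closed[OF H] by simp
qed (simp_all add: submonoid.one_closed[OF H])

lemma (in comm_monoid) finprod_permute:
  assumes \<tau>: "\<tau> permutes S" and "g \<in> S \<rightarrow> carrier G"
  shows "(\<Otimes>i\<in>S. g (\<tau> i)) = (\<Otimes>i\<in>S. g i)"
proof -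
  have "(\<Otimes>i\<in>\<tau> ` S. g i) = (\<Otimes>i\<in>S. g (\<tau> i))"
    using assms(2) permutes_inj_on[OF \<tau>]
    by (intro finprod_reindex) (simp_all only: permutes_image[OF \<tau>])
  then show ?thesis by (simp only: permutes_image[OF \<tau>])
qed

lemma (in comm_monoid) finprod_swap:
  assumes "\<And>a b. a \<in> A \<Longrightarrow> b \<in> B \<Longrightarrow> g a b \<in> carrier G"
  shows "(\<Otimes>a\<in>A. \<Otimes>b\<in>B. g a b) = (\<Otimes>b\<in>B. \<Otimes>a\<in>A. g a b)"
  using assms
proof (induction A rule: infinite_finite_induct)
  case (insert a A)
  have "(\<Otimes>a\<in>insert a A. \<Otimes>b\<in>B. g a b) = (\<Otimes>b\<in>B. g a b) \<otimes> (\<Otimes>b\<in>B. \<Otimes>a\<in>A. g a b)"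
    using insert by (simp add: Pi_def)
  also have "\<dots> = (\<Otimes>b\<in>B. g a b \<otimes> (\<Otimes>a\<in>A. g a b))"
    by (rule finprod_multf[symmetric]) (use insert in \<open>auto intro!: finprod_closed\<close>)
  also have "\<dots> = (\<Otimes>b\<in>B. \<Otimes>a\<in>insert a A. g a b)"
    by (rule finprod_cong') (use insert in \<open>auto simp: Pi_def\<close>)
  finally show ?case .
qed simp_all

lemma (in comm_group) finprod_int_pow:
  fixes k :: int
  assumes "f \<in> A \<rightarrow> carrier G"
  shows "(\<Otimes>a\<in>A. f a [^] k) = (\<Otimes>a\<in>A. f a) [^] k"
  using assms
  by (induction A rule: infinite_finite_induct) (simp_all add: Pi_def int_pow_distrib)

lemma (in comm_monoid) finprod_insert_upd:
  assumes "finite S" "a \<notin> S" "g a p \<in> carrier G" "\<And>i. i \<in> S \<Longrightarrow> g i (f i) \<in> carrier G"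
  shows "(\<Otimes>i\<in>insert a S. g i ((f(a := p)) i)) = g a p \<otimes> (\<Otimes>i\<in>S. g i (f i))"
proof -
  have "(\<Otimes>i\<in>S. g i ((f(a := p)) i)) = (\<Otimes>i\<in>S. g i (f i))"
    by (rule finprod_cong') (use assms in auto)
  then show ?thesis using assms by (simp add: Pi_def)
qed

lemma (in comm_monoid) finprod_PiE_insert:
  assumes "a \<notin> S" and fin: "finite S" "\<And>i. i \<in> insert a S \<Longrightarrow> finite (B i)"
    and h: "\<And>f. f \<in> Pi\<^sub>E (insert a S) B \<Longrightarrow> h f \<in> carrier G"
  shows "(\<Otimes>f\<in>Pi\<^sub>E (insert a S) B. h f) = (\<Otimes>p\<in>B a. \<Otimes>f\<in>Pi\<^sub>E S B. h (f(a := p)))"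
proof -
  let ?upd = "\<lambda>p f. f(a := p)"
  have split: "Pi\<^sub>E (insert a S) B = (\<Union>p\<in>B a. ?upd p ` Pi\<^sub>E S B)"
    unfolding PiE_insert_eq by auto
  have upd: "?upd p f \<in> Pi\<^sub>E (insert a S) B" if "p \<in> B a" "f \<in> Pi\<^sub>E S B" for p f
    using that by (simp add: PiE_fun_upd)
  have "(\<Otimes>f\<in>Pi\<^sub>E (insert a S) B. h f) = (\<Otimes>p\<in>B a. \<Otimes>f\<in>?upd p ` Pi\<^sub>E S B. h f)"
    unfolding split
  proof (rule finprod_UN_disjoint)
    show "pairwise (\<lambda>p q. disjnt (?upd p ` Pi\<^sub>E S B) (?upd q ` Pi\<^sub>E S B)) (B a)"
      by (auto simp: pairwise_def disjnt_iff dest: fun_upd_eqD)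
  qed (use fin upd h in \<open>auto intro!: finite_PiE\<close>)
  also have "\<dots> = (\<Otimes>p\<in>B a. \<Otimes>f\<in>Pi\<^sub>E S B. h (?upd p f))"
  proof (rule finprod_cong'[OF refl])
    fix p assume p: "p \<in> B a"
    show "(\<Otimes>f\<in>?upd p ` Pi\<^sub>E S B. h f) = (\<Otimes>f\<in>Pi\<^sub>E S B. h (?upd p f))"
    proof (rule finprod_reindex)
      show "inj_on (?upd p) (Pi\<^sub>E S B)"
        using \<open>a \<notin> S\<close> by (intro inj_onI) (metis PiE_arb fun_upd_triv fun_upd_upd)
    qed (use p upd h in auto)
  qed (use upd h in \<open>auto intro!: finprod_closed\<close>)
  finally show ?thesis .
qed

lemma (in cring) finprod_finsum_distrib:
  assumes "finite S" "\<And>i. i \<in> S \<Longrightarrow> finite (B i)"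
    and "\<And>i p. i \<in> S \<Longrightarrow> p \<in> B i \<Longrightarrow> g i p \<in> carrier R"
  shows "(\<Otimes>i\<in>S. \<Oplus>p\<in>B i. g i p) = (\<Oplus>f\<in>Pi\<^sub>E S B. \<Otimes>i\<in>S. g i (f i))"
  using assms
proof (induction S rule: finite_induct)
  case empty
  then show ?case by simp
next
  case (insert a S)
  have closed: "g i (f i) \<in> carrier R" if "f \<in> Pi\<^sub>E S B" "i \<in> S" for f i
    using that insert.prems(2) by auto
  have insert_closed: "(\<Otimes>i\<in>insert a S. g i (f i)) \<in> carrier R" if "f \<in> Pi\<^sub>E (insert a S) B" for f
    using PiE_mem[OF that] insert.prems(2) by (intro finprod_closed) simp
  have fin: "finite (Pi\<^sub>E S B)" using insert by (intro finite_PiE) auto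
  have upd: "(\<Otimes>i\<in>insert a S. g i ((f(a := p)) i)) = g a p \<otimes> (\<Otimes>i\<in>S. g i (f i))"
    if "p \<in> B a" "f \<in> Pi\<^sub>E S B" for p f
    using insert.hyps(1,2) insert.prems(2)[OF _ that(1)] closed[OF that(2)]
    by (intro finprod_insert_upd) simp_all
  have "(\<Oplus>f\<in>Pi\<^sub>E (insert a S) B. \<Otimes>i\<in>insert a S. g i (f i)) =
      (\<Oplus>p\<in>B a. \<Oplus>f\<in>Pi\<^sub>E S B. \<Otimes>i\<in>insert a S. g i ((f(a := p)) i))"
    by (rule add.finprod_PiE_insert) (use insert.hyps insert.prems(1) insert_closed in simp_all)
  also have "\<dots> = (\<Oplus>p\<in>B a. g a p \<otimes> (\<Oplus>f\<in>Pi\<^sub>E S B. \<Otimes>i\<in>S. g i (f i)))"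
  proof (rule finsum_cong'[OF refl])
    fix p assume p: "p \<in> B a"
    have "(\<Oplus>f\<in>Pi\<^sub>E S B. \<Otimes>i\<in>insert a S. g i ((f(a := p)) i)) =
        (\<Oplus>f\<in>Pi\<^sub>E S B. g a p \<otimes> (\<Otimes>i\<in>S. g i (f i)))"
      by (rule finsum_cong') (use p upd closed insert in auto)
    also have "\<dots> = g a p \<otimes> (\<Oplus>f\<in>Pi\<^sub>E S B. \<Otimes>i\<in>S. g i (f i))"
      by (rule finsum_rdistr[symmetric]) (use p fin closed insert in auto)
    finally show "(\<Oplus>f\<in>Pi\<^sub>E S B. \<Otimes>i\<in>insert a S. g i ((f(a := p)) i)) =
        g a p \<otimes> (\<Oplus>f\<in>Pi\<^sub>E S B. \<Otimes>i\<in>S. g i (f i))" .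
  qed (use closed insert in \<open>auto intro!: finsum_closed\<close>)
  also have "\<dots> = (\<Oplus>p\<in>B a. g a p) \<otimes> (\<Oplus>f\<in>Pi\<^sub>E S B. \<Otimes>i\<in>S. g i (f i))"
    by (rule finsum_ldistr[symmetric]) (use closed insert in \<open>auto intro!: finsum_closed\<close>)
  also have "\<dots> = (\<Otimes>i\<in>insert a S. \<Oplus>p\<in>B i. g i p)"
    using insert by (simp add: finsum_closed Pi_def)
  finally show ?case ..
qed

lemma (in cring) finprod_finsum_mult_distrib:
  assumes "finite S" "finite B"
    and g: "\<And>i p. i \<in> S \<Longrightarrow> p \<in> B \<Longrightarrow> g i p \<in> carrier R"
    and h: "\<And>i p. i \<in> S \<Longrightarrow> p \<in> B \<Longrightarrow> h i p \<in> carrier R"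
  shows "(\<Otimes>i\<in>S. \<Oplus>p\<in>B. g i p \<otimes> h i p) =
    (\<Oplus>f\<in>S \<rightarrow>\<^sub>E B. (\<Otimes>i\<in>S. g i (f i)) \<otimes> (\<Otimes>i\<in>S. h i (f i)))"
proof -
  have closed: "g i (f i) \<in> carrier R" "h i (f i) \<in> carrier R" if "f \<in> S \<rightarrow>\<^sub>E B" "i \<in> S" for f i
    using PiE_mem[OF that] that(2) g h by simp_all
  have "(\<Otimes>i\<in>S. \<Oplus>p\<in>B. g i p \<otimes> h i p) = (\<Oplus>f\<in>S \<rightarrow>\<^sub>E B. \<Otimes>i\<in>S. g i (f i) \<otimes> h i (f i))"
    using assms by (intro finprod_finsum_distrib) simp_all
  also have "\<dots> = (\<Oplus>f\<in>S \<rightarrow>\<^sub>E B. (\<Otimes>i\<in>S. g i (f i)) \<otimes> (\<Otimes>i\<in>S. h i (f i)))"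
    by (rule finsum_cong') (simp_all add: closed Pi_iff)
  finally show ?thesis .
qed

lemma bij_betw_permutes_injections:
  assumes "finite S"
  shows "bij_betw (\<lambda>\<sigma>. restrict \<sigma> S) {\<sigma>. \<sigma> permutes S} {f \<in> S \<rightarrow>\<^sub>E S. inj_on f S}"
proof (rule bij_betw_byWitness[where f' = "\<lambda>f. restrict_id f S"])
  show "(\<lambda>f. restrict_id f S) ` {f \<in> S \<rightarrow>\<^sub>E S. inj_on f S} \<subseteq> {\<sigma>. \<sigma> permutes S}"
  proof clarify
    fix f assume "f \<in> S \<rightarrow>\<^sub>E S" "inj_on f S"
    then have "bij_betw f S S"
      using endo_inj_surj[OF assms, of f] by (auto simp: bij_betw_def)
    then show "restrict_id f S permutes S" by (rule permutes_restrict_id)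
  qed
  show "(\<lambda>\<sigma>. restrict \<sigma> S) ` {\<sigma>. \<sigma> permutes S} \<subseteq> {f \<in> S \<rightarrow>\<^sub>E S. inj_on f S}"
    by (auto simp: permutes_inj_on permutes_in_image)
  show "\<forall>\<sigma>\<in>{\<sigma>. \<sigma> permutes S}. restrict_id (restrict \<sigma> S) S = \<sigma>"
    by (auto simp: fun_eq_iff restrict_id_def permutes_def)
  show "\<forall>f\<in>{f \<in> S \<rightarrow>\<^sub>E S. inj_on f S}. restrict (restrict_id f S) S = f"
    by (auto simp: fun_eq_iff restrict_id_def PiE_def extensional_def)
qed

lemma (in comm_monoid) finprod_injections_eq_permutations:
  assumes "finite S" and g: "\<And>f. f \<in> S \<rightarrow>\<^sub>E S \<Longrightarrow> g f \<in> carrier G"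
  shows "(\<Otimes>f\<in>{f \<in> S \<rightarrow>\<^sub>E S. inj_on f S}. g f) = (\<Otimes>\<sigma>\<in>{\<sigma>. \<sigma> permutes S}. g (restrict \<sigma> S))"
proof -
  note bij = bij_betw_permutes_injections[OF assms(1)]
  show ?thesis
    unfolding bij_betw_imp_surj_on[OF bij, symmetric]
    by (rule finprod_reindex[OF _ bij_betw_imp_inj_on[OF bij]])
      (use g bij_betw_imp_surj_on[OF bij] in blast)
qed

section \<open>Determinants over a commutative ring\<close>

lemma evenperm_comp_transpose:
  assumes "finite S" "i \<in> S" "j \<in> S" "i \<noteq> j" "\<sigma> permutes S"
  shows "evenperm (\<sigma> \<circ> transpose i j) \<longleftrightarrow> \<not> evenperm \<sigma>"
proof -
  have "permutation \<sigma>" using assms by (auto simp: permutation_permutes)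
  then show ?thesis
    using \<open>i \<noteq> j\<close> by (simp add: evenperm_comp permutation_swap_id evenperm_swap)
qed

lemma odd_permutations_eq_image:
  assumes "finite S" "i \<in> S" "j \<in> S" "i \<noteq> j"
  shows "{\<sigma>. \<sigma> permutes S \<and> \<not> evenperm \<sigma>} =
    (\<lambda>\<sigma>. \<sigma> \<circ> transpose i j) ` {\<sigma>. \<sigma> permutes S \<and> evenperm \<sigma>}" (is "?odd = ?comp ` ?even")
proof -
  note comp_permutes = permutes_compose[OF permutes_swap_id[OF assms(2,3)]]
  note comp_even = evenperm_comp_transpose[OF assms]
  show ?thesis
  proof (intro equalityI subsetI)
    fix \<sigma> assume "\<sigma> \<in> ?odd"
    then have "?comp \<sigma> \<in> ?even" using comp_permutes comp_even by auto
    moreover have "\<sigma> = ?comp (?comp \<sigma>)" by (simp add: comp_assoc)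
    ultimately show "\<sigma> \<in> ?comp ` ?even" by blast
  qed (use comp_permutes comp_even in auto)
qed

context cring
begin

definition det :: "'i set \<Rightarrow> ('i \<Rightarrow> 'i \<Rightarrow> 'a) \<Rightarrow> 'a"
  where "det S M = (\<Oplus>\<sigma>\<in>{\<sigma>. \<sigma> permutes S}. [sign \<sigma>] \<cdot> (\<Otimes>i\<in>S. M i (\<sigma> i)))"

lemma finprod_permuted_entries_closed:
  assumes "\<And>i j. i \<in> S \<Longrightarrow> j \<in> S \<Longrightarrow> M i j \<in> carrier R" and "\<sigma> permutes S"
  shows "(\<Otimes>i\<in>S. M i (\<sigma> i)) \<in> carrier R"
  using assms by (intro finprod_closed) (auto simp: permutes_in_image)

lemma det_closed:
  assumes "\<And>i j. i \<in> S \<Longrightarrow> j \<in> S \<Longrightarrow> M i j \<in> carrier R"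
  shows "det S M \<in> carrier R"
  unfolding det_def using finprod_permuted_entries_closed[of S M] assms
  by (intro finsum_closed Pi_I add.int_pow_closed) auto

lemma det_in_subring:
  assumes H: "subring H R" and M: "\<And>i j. i \<in> S \<Longrightarrow> j \<in> S \<Longrightarrow> M i j \<in> H"
  shows "det S M \<in> H"
  unfolding det_def
proof (rule add.finprod_in_submonoid)
  have add_subgroup: "subgroup H (add_monoid R)" and mult_submonoid: "submonoid H R"
    using H by (auto dest: subring.axioms)
  show "submonoid H (add_monoid R)" using add_subgroup by (rule subgroup.subgroup_is_submonoid)
  have "(\<Otimes>i\<in>S. M i (\<sigma> i)) \<in> H" if "\<sigma> permutes S" for \<sigma>
    using that M by (intro finprod_in_submonoid[OF mult_submonoid]) (auto simp: permutes_in_image)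
  then show "(\<lambda>\<sigma>. [sign \<sigma>] \<cdot> (\<Otimes>i\<in>S. M i (\<sigma> i))) \<in> {\<sigma>. \<sigma> permutes S} \<rightarrow> H"
    using add.subgroup_int_pow_closed[OF add_subgroup] by blast
qed

lemma det_cong:
  assumes "\<And>i j. i \<in> S \<Longrightarrow> j \<in> S \<Longrightarrow> M i j = N i j"
    and "\<And>i j. i \<in> S \<Longrightarrow> j \<in> S \<Longrightarrow> N i j \<in> carrier R"
  shows "det S M = det S N"
proof -
  have closed: "(\<Otimes>i\<in>S. N i (\<sigma> i)) \<in> carrier R" if "\<sigma> permutes S" for \<sigma>
    using assms(2) that by (rule finprod_permuted_entries_closed)
  have eq: "(\<Otimes>i\<in>S. M i (\<sigma> i)) = (\<Otimes>i\<in>S. N i (\<sigma> i))" if "\<sigma> permutes S" for \<sigma>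
    by (rule finprod_cong') (use that assms in \<open>auto simp: permutes_in_image\<close>)
  show ?thesis
    unfolding det_def by (rule finsum_cong') (use closed eq in auto)
qed

lemma det_transpose:
  assumes "finite S" and M: "\<And>i j. i \<in> S \<Longrightarrow> j \<in> S \<Longrightarrow> M i j \<in> carrier R"
  shows "det S (\<lambda>i j. M j i) = det S M"
proof -
  let ?perms = "{\<sigma>. \<sigma> permutes S}" and ?inv = "inv_into UNIV"
  have prod_closed: "(\<Otimes>i\<in>S. M i (\<sigma> i)) \<in> carrier R" if "\<sigma> permutes S" for \<sigma>
    using M that by (rule finprod_permuted_entries_closed)
  have "det S M = (\<Oplus>\<sigma>\<in>?inv ` ?perms. [sign \<sigma>] \<cdot> (\<Otimes>i\<in>S. M i (\<sigma> i)))"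
    using image_inverse_permutations[of S] by (simp add: det_def image_Collect)
  also have "\<dots> = (\<Oplus>\<sigma>\<in>?perms. [sign (?inv \<sigma>)] \<cdot> (\<Otimes>i\<in>S. M i (?inv \<sigma> i)))"
    by (rule finsum_reindex[OF _ inv_inj_on_permutes]) (use prod_closed permutes_inv in auto)
  also have "\<dots> = det S (\<lambda>i j. M j i)"
    unfolding det_def
  proof (rule finsum_cong'[OF refl])
    fix \<sigma> assume "\<sigma> \<in> ?perms"
    then have \<sigma>: "\<sigma> permutes S" by simp
    have "(\<Otimes>i\<in>S. M i (?inv \<sigma> i)) = (\<Otimes>i\<in>S. M (\<sigma> i) i)"
      using finprod_permute[OF \<sigma>, of "\<lambda>i. M i (?inv \<sigma> i)"] M
      by (simp add: permutes_inverses[OF \<sigma>] permutes_in_image[OF permutes_inv[OF \<sigma>]])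
    moreover have "sign (?inv \<sigma>) = sign \<sigma>"
      using \<sigma> \<open>finite S\<close> by (intro sign_inverse) (auto simp: permutation_permutes)
    ultimately show "[sign (?inv \<sigma>)] \<cdot> (\<Otimes>i\<in>S. M i (?inv \<sigma> i)) = [sign \<sigma>] \<cdot> (\<Otimes>j\<in>S. M (\<sigma> j) j)"
      by simp
  qed (use M in \<open>auto simp: permutes_in_image intro!: add.int_pow_closed finprod_closed\<close>)
  finally show ?thesis ..
qed

lemma det_permute_rows:
  assumes "finite S" and \<tau>: "\<tau> permutes S"
    and M: "\<And>i j. i \<in> S \<Longrightarrow> j \<in> S \<Longrightarrow> M i j \<in> carrier R"
  shows "det S (\<lambda>i. M (\<tau> i)) = [sign \<tau>] \<cdot> det S M"
proof -
  let ?perms = "{\<sigma>. \<sigma> permutes S}" and ?prod = "\<lambda>\<sigma>. \<Otimes>i\<in>S. M i (\<sigma> i)"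
  have prod_closed: "?prod \<sigma> \<in> carrier R" if "\<sigma> permutes S" for \<sigma>
    using M that by (rule finprod_permuted_entries_closed)
  have prod_comp: "(\<Otimes>i\<in>S. M (\<tau> i) ((\<sigma> \<circ> \<tau>) i)) = ?prod \<sigma>" if "\<sigma> permutes S" for \<sigma>
    using finprod_permute[OF \<tau>, of "\<lambda>i. M i (\<sigma> i)"] that M by (simp add: permutes_in_image)
  have "det S (\<lambda>i. M (\<tau> i)) =
      (\<Oplus>\<sigma>\<in>(\<lambda>\<sigma>. \<sigma> \<circ> \<tau>) ` ?perms. [sign \<sigma>] \<cdot> (\<Otimes>i\<in>S. M (\<tau> i) (\<sigma> i)))"
    using image_compose_permutations_right[OF \<tau>] by (simp add: det_def image_Collect)
  also have "\<dots> = (\<Oplus>\<sigma>\<in>?perms. [sign (\<sigma> \<circ> \<tau>)] \<cdot> (\<Otimes>i\<in>S. M (\<tau> i) ((\<sigma> \<circ> \<tau>) i)))"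
  proof (rule finsum_reindex)
    show "inj_on (\<lambda>\<sigma>. \<sigma> \<circ> \<tau>) ?perms"
      using permutes_surj[OF \<tau>] by (auto intro!: inj_onI simp: fun_eq_iff surj_def) metis
  qed (use \<tau> M in \<open>auto simp: permutes_in_image intro!: add.int_pow_closed finprod_closed\<close>)
  also have "\<dots> = (\<Oplus>\<sigma>\<in>?perms. [sign \<tau>] \<cdot> ([sign \<sigma>] \<cdot> ?prod \<sigma>))"
  proof (rule finsum_cong'[OF refl])
    fix \<sigma> assume \<sigma>: "\<sigma> \<in> ?perms"
    then have "sign (\<sigma> \<circ> \<tau>) = sign \<sigma> * sign \<tau>"
      using \<tau> \<open>finite S\<close> by (intro sign_compose) (auto simp: permutation_permutes)
    then show "[sign (\<sigma> \<circ> \<tau>)] \<cdot> (\<Otimes>i\<in>S. M (\<tau> i) ((\<sigma> \<circ> \<tau>) i)) = [sign \<tau>] \<cdot> ([sign \<sigma>] \<cdot> ?prod \<sigma>)"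
      using \<sigma> prod_closed prod_comp by (simp add: add.int_pow_pow)
  qed (use prod_closed in auto)
  also have "\<dots> = [sign \<tau>] \<cdot> det S M"
    unfolding det_def by (rule add.finprod_int_pow) (use prod_closed in auto)
  finally show ?thesis .
qed

lemma finprod_entries_comp_transpose:
  assumes ij: "i \<in> S" "j \<in> S" and "\<And>k. k \<in> S \<Longrightarrow> M i k = M j k"
    and M: "\<And>k l. k \<in> S \<Longrightarrow> l \<in> S \<Longrightarrow> M k l \<in> carrier R" and \<sigma>: "\<sigma> permutes S"
  shows "(\<Otimes>k\<in>S. M k ((\<sigma> \<circ> transpose i j) k)) = (\<Otimes>k\<in>S. M k (\<sigma> k))"
proof -
  let ?\<tau> = "transpose i j"
  have "(\<Otimes>k\<in>S. M k ((\<sigma> \<circ> ?\<tau>) k)) = (\<Otimes>k\<in>S. M (?\<tau> k) (\<sigma> (?\<tau> k)))"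
    by (rule finprod_cong') (use assms in \<open>auto simp: permutes_in_image transpose_def\<close>)
  also have "\<dots> = (\<Otimes>k\<in>S. M k (\<sigma> k))"
    using finprod_permute[OF permutes_swap_id[OF ij], of "\<lambda>k. M k (\<sigma> k)"] \<sigma> M
    by (simp add: permutes_in_image)
  finally show ?thesis .
qed

text \<open>
  \<open>det_permute_rows\<close> only gives \<open>2 det M = 0\<close>, so even and odd permutations are paired instead.
\<close>

lemma det_identical_rows:
  assumes "finite S" and ij: "i \<in> S" "j \<in> S" "i \<noteq> j"
    and rows: "\<And>k. k \<in> S \<Longrightarrow> M i k = M j k"
    and M: "\<And>k l. k \<in> S \<Longrightarrow> l \<in> S \<Longrightarrow> M k l \<in> carrier R"
  shows "det S M = \<zero>"
proof -
  let ?\<tau> = "transpose i j"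
  let ?even = "{\<sigma>. \<sigma> permutes S \<and> evenperm \<sigma>}" and ?odd = "{\<sigma>. \<sigma> permutes S \<and> \<not> evenperm \<sigma>}"
  let ?prod = "\<lambda>\<sigma>. \<Otimes>k\<in>S. M k (\<sigma> k)"
  have \<tau>: "?\<tau> permutes S" using ij by (simp add: permutes_swap_id)
  have prod_closed: "?prod \<sigma> \<in> carrier R" if "\<sigma> permutes S" for \<sigma>
    using M that by (rule finprod_permuted_entries_closed)
  have even_comp: "evenperm (\<sigma> \<circ> ?\<tau>) \<longleftrightarrow> \<not> evenperm \<sigma>" if "\<sigma> permutes S" for \<sigma>
    using \<open>finite S\<close> ij that by (rule evenperm_comp_transpose)
  have prod_comp: "?prod (\<sigma> \<circ> ?\<tau>) = ?prod \<sigma>" if "\<sigma> permutes S" for \<sigma>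
    using ij(1,2) rows M that by (rule finprod_entries_comp_transpose)
  note odd = odd_permutations_eq_image[OF \<open>finite S\<close> ij]
  have "det S M = (\<Oplus>\<sigma>\<in>?even \<union> ?odd. [sign \<sigma>] \<cdot> ?prod \<sigma>)"
    unfolding det_def by (rule arg_cong[where f = "finsum R _"]) auto
  also have "\<dots> = (\<Oplus>\<sigma>\<in>?even. [sign \<sigma>] \<cdot> ?prod \<sigma>) \<oplus> (\<Oplus>\<sigma>\<in>?odd. [sign \<sigma>] \<cdot> ?prod \<sigma>)"
    by (rule finsum_Un_disjoint) (use prod_closed finite_permutations[OF \<open>finite S\<close>] in auto)
  also have "(\<Oplus>\<sigma>\<in>?odd. [sign \<sigma>] \<cdot> ?prod \<sigma>) = (\<Oplus>\<sigma>\<in>?even. [sign (\<sigma> \<circ> ?\<tau>)] \<cdot> ?prod (\<sigma> \<circ> ?\<tau>))"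
    unfolding odd
  proof (rule finsum_reindex)
    show "inj_on (\<lambda>\<sigma>. \<sigma> \<circ> ?\<tau>) ?even"
      by (rule inj_on_inverseI[where g = "\<lambda>\<sigma>. \<sigma> \<circ> ?\<tau>"]) (simp add: comp_assoc)
  qed (use prod_closed odd in blast)
  also have "(\<Oplus>\<sigma>\<in>?even. [sign \<sigma>] \<cdot> ?prod \<sigma>) \<oplus> \<dots> =
      (\<Oplus>\<sigma>\<in>?even. [sign \<sigma>] \<cdot> ?prod \<sigma> \<oplus> [sign (\<sigma> \<circ> ?\<tau>)] \<cdot> ?prod (\<sigma> \<circ> ?\<tau>))"
    by (rule finsum_addf[symmetric])
      (use prod_closed prod_comp permutes_compose[OF \<tau>] in auto)
  also have "\<dots> = \<zero>"
    by (rule add.finprod_one_eqI)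
      (use prod_closed prod_comp even_comp in \<open>auto simp: sign_def add.int_pow_neg r_neg\<close>)
  finally show ?thesis .
qed

lemma det_mult_expand:
  assumes "finite S"
    and M: "\<And>i j. i \<in> S \<Longrightarrow> j \<in> S \<Longrightarrow> M i j \<in> carrier R"
    and N: "\<And>i j. i \<in> S \<Longrightarrow> j \<in> S \<Longrightarrow> N i j \<in> carrier R"
  shows "det S (\<lambda>i j. \<Oplus>p\<in>S. M i p \<otimes> N p j) =
    (\<Oplus>f\<in>S \<rightarrow>\<^sub>E S. (\<Otimes>i\<in>S. M i (f i)) \<otimes> det S (\<lambda>i. N (f i)))"
proof -
  let ?perms = "{\<sigma>. \<sigma> permutes S}" and ?maps = "S \<rightarrow>\<^sub>E S"
  let ?m = "\<lambda>f. \<Otimes>i\<in>S. M i (f i)" and ?n = "\<lambda>f \<sigma>. \<Otimes>i\<in>S. N (f i) (\<sigma> i)"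
  have fin: "finite ?perms" "finite ?maps"
    using \<open>finite S\<close> by (simp_all add: finite_permutations finite_PiE)
  have maps: "f i \<in> S" if "f \<in> ?maps" "i \<in> S" for f i
    using that by auto
  have m: "?m f \<in> carrier R" if "f \<in> ?maps" for f
    using that M by (intro finprod_closed) auto
  have n: "?n f \<sigma> \<in> carrier R" if "f \<in> ?maps" "\<sigma> permutes S" for f \<sigma>
    using that maps N by (intro finprod_closed) (auto simp: permutes_in_image)
  have "det S (\<lambda>i j. \<Oplus>p\<in>S. M i p \<otimes> N p j) =
      (\<Oplus>\<sigma>\<in>?perms. \<Oplus>f\<in>?maps. [sign \<sigma>] \<cdot> (?m f \<otimes> ?n f \<sigma>))"
    unfolding det_def
  proof (rule finsum_cong'[OF refl])
    fix \<sigma> assume "\<sigma> \<in> ?perms"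
    then have \<sigma>: "\<sigma> permutes S" by simp
    have "(\<Otimes>i\<in>S. \<Oplus>p\<in>S. M i p \<otimes> N p (\<sigma> i)) = (\<Oplus>f\<in>?maps. ?m f \<otimes> ?n f \<sigma>)"
      using \<open>finite S\<close> \<sigma> M N by (intro finprod_finsum_mult_distrib) (auto simp: permutes_in_image)
    then show "[sign \<sigma>] \<cdot> (\<Otimes>i\<in>S. \<Oplus>p\<in>S. M i p \<otimes> N p (\<sigma> i)) =
        (\<Oplus>f\<in>?maps. [sign \<sigma>] \<cdot> (?m f \<otimes> ?n f \<sigma>))"
      using m n \<sigma> by (simp add: add.finprod_int_pow Pi_def)
  qed (use m n in \<open>auto intro!: finsum_closed\<close>)
  also have "\<dots> = (\<Oplus>f\<in>?maps. \<Oplus>\<sigma>\<in>?perms. [sign \<sigma>] \<cdot> (?m f \<otimes> ?n f \<sigma>))"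
    by (rule add.finprod_swap) (use m n in auto)
  also have "\<dots> = (\<Oplus>f\<in>?maps. ?m f \<otimes> det S (\<lambda>i. N (f i)))"
  proof (rule finsum_cong'[OF refl])
    fix f assume "f \<in> ?maps"
    then show "(\<Oplus>\<sigma>\<in>?perms. [sign \<sigma>] \<cdot> (?m f \<otimes> ?n f \<sigma>)) = ?m f \<otimes> det S (\<lambda>i. N (f i))"
      unfolding det_def using fin m n
      by (subst finsum_rdistr) (auto simp: add_pow_rdistr_int intro!: finsum_cong')
  qed (use maps m N in \<open>auto intro!: det_closed\<close>)
  finally show ?thesis .
qed

lemma det_restrict_rows:
  assumes "finite S" and \<sigma>: "\<sigma> permutes S"
    and M: "\<And>i j. i \<in> S \<Longrightarrow> j \<in> S \<Longrightarrow> M i j \<in> carrier R"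
  shows "det S (\<lambda>i. M (restrict \<sigma> S i)) = [sign \<sigma>] \<cdot> det S M"
proof -
  have "det S (\<lambda>i. M (restrict \<sigma> S i)) = det S (\<lambda>i. M (\<sigma> i))"
    by (rule det_cong) (use \<sigma> M in \<open>auto simp: permutes_in_image\<close>)
  then show ?thesis using det_permute_rows[OF assms(1) \<sigma>, of M] M by simp
qed

lemma det_mult:
  assumes "finite S"
    and M: "\<And>i j. i \<in> S \<Longrightarrow> j \<in> S \<Longrightarrow> M i j \<in> carrier R"
    and N: "\<And>i j. i \<in> S \<Longrightarrow> j \<in> S \<Longrightarrow> N i j \<in> carrier R"
  shows "det S (\<lambda>i j. \<Oplus>p\<in>S. M i p \<otimes> N p j) = det S M \<otimes> det S N"
proof -
  let ?perms = "{\<sigma>. \<sigma> permutes S}" and ?maps = "S \<rightarrow>\<^sub>E S" and ?injs = "{f \<in> S \<rightarrow>\<^sub>E S. inj_on f S}"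
  let ?term = "\<lambda>f. (\<Otimes>i\<in>S. M i (f i)) \<otimes> det S (\<lambda>i. N (f i))"
  have maps: "f i \<in> S" if "f \<in> ?maps" "i \<in> S" for f i
    using that by auto
  have term_closed: "?term f \<in> carrier R" if "f \<in> ?maps" for f
    using that maps M N by (intro m_closed finprod_closed det_closed) auto
  have prod_closed: "(\<Otimes>i\<in>S. M i (\<sigma> i)) \<in> carrier R" if "\<sigma> permutes S" for \<sigma>
    using M that by (rule finprod_permuted_entries_closed)
  have det_N: "det S N \<in> carrier R" using N by (rule det_closed)
  have "det S (\<lambda>i j. \<Oplus>p\<in>S. M i p \<otimes> N p j) = (\<Oplus>f\<in>?maps. ?term f)"
    using assms by (rule det_mult_expand)
  also have "\<dots> = (\<Oplus>f\<in>?injs. ?term f)"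
  proof (rule add.finprod_mono_neutral_cong_right)
    fix f assume f: "f \<in> ?maps - ?injs"
    then obtain i j where "i \<in> S" "j \<in> S" "i \<noteq> j" "f i = f j" by (auto simp: inj_on_def)
    then have "det S (\<lambda>i. N (f i)) = \<zero>"
      using \<open>finite S\<close> N f by (intro det_identical_rows[of S i j]) auto
    then show "?term f = \<zero>" using f M by (simp add: finprod_closed Pi_def PiE_def)
  qed (use \<open>finite S\<close> term_closed in \<open>auto simp: finite_PiE\<close>)
  also have "\<dots> = (\<Oplus>\<sigma>\<in>?perms. ?term (restrict \<sigma> S))"
    using \<open>finite S\<close> term_closed by (rule add.finprod_injections_eq_permutations)
  also have "\<dots> = (\<Oplus>\<sigma>\<in>?perms. [sign \<sigma>] \<cdot> (\<Otimes>i\<in>S. M i (\<sigma> i)) \<otimes> det S N)"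
  proof (rule finsum_cong'[OF refl])
    fix \<sigma> assume "\<sigma> \<in> ?perms"
    then have \<sigma>: "\<sigma> permutes S" by simp
    have "(\<Otimes>i\<in>S. M i (restrict \<sigma> S i)) = (\<Otimes>i\<in>S. M i (\<sigma> i))"
      by (rule finprod_cong') (use \<sigma> M in \<open>auto simp: permutes_in_image\<close>)
    then show "?term (restrict \<sigma> S) = [sign \<sigma>] \<cdot> (\<Otimes>i\<in>S. M i (\<sigma> i)) \<otimes> det S N"
      using det_restrict_rows[OF \<open>finite S\<close> \<sigma>, of N] N prod_closed[OF \<sigma>] det_N
      by (simp add: add_pow_ldistr_int add_pow_rdistr_int del: restrict_apply)
  qed (use prod_closed det_N in auto)
  also have "\<dots> = det S M \<otimes> det S N"
    unfolding det_def[of S M]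
    by (rule finsum_ldistr[symmetric])
      (use prod_closed det_N finite_permutations[OF \<open>finite S\<close>] in auto)
  finally show ?thesis .
qed

end

section \<open>Algebras and subalgebras\<close>

lemma cring_if_same_operations:
  assumes "cring Q" "carrier T = carrier Q" "mult T = mult Q" "one T = one Q"
    "zero T = zero Q" "add T = add Q"
  shows "cring T"
proof -
  interpret cring Q by fact
  show ?thesis
    by (intro cringI abelian_groupI comm_monoidI)
      (auto simp: assms(2-) a_ac m_ac l_distr r_distr intro: l_neg)
qed

lemma algebra_if_smult_eq_hom_mult:
  assumes A: "cring A" and M: "cring M" and \<phi>: "\<phi> \<in> ring_hom A M"
    and smult: "\<And>a x. a \<in> carrier A \<Longrightarrow> x \<in> carrier M \<Longrightarrow> a \<odot>\<^bsub>M\<^esub> x = \<phi> a \<otimes>\<^bsub>M\<^esub> x"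
  shows "algebra A M"
proof -
  interpret ring_hom_cring A M \<phi>
    using A M \<phi> by (intro ring_hom_cring.intro ring_hom_cring_axioms.intro)
  show ?thesis
    by (rule algebraI) (simp_all add: A M smult S.l_distr S.r_distr S.m_assoc)
qed

context algebra
begin

lemma scalar_ring_hom: "(\<lambda>a. a \<odot>\<^bsub>M\<^esub> \<one>\<^bsub>M\<^esub>) \<in> ring_hom R M"
  by (rule ring_hom_memI) (simp_all add: smult_l_distr smult_assoc1 smult_assoc2)

lemma algebra_subalgebra:
  assumes "is_subalgebra R M B"
  shows "algebra R (M\<lparr>carrier := B\<rparr>)"
proof -
  have B: "subring B M" and smult: "\<And>a b. a \<in> carrier R \<Longrightarrow> b \<in> B \<Longrightarrow> a \<odot>\<^bsub>M\<^esub> b \<in> B"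
    using assms by (auto simp: is_subalgebra_def)
  note B_carrier = subsetD[OF subringE(1)[OF B]]
  show ?thesis
  proof (rule algebraI)
    show "cring (M\<lparr>carrier := B\<rparr>)"
      using subcring_iff[OF subringE(1)[OF B]] subcringI'[OF B] by simp
  qed (simp_all add: R_cring smult B_carrier smult_l_distr smult_r_distr smult_assoc1 smult_assoc2)
qed

lemma is_subalgebra_carrier: "is_subalgebra R M (carrier M)"
  by (simp add: is_subalgebra_def carrier_is_subring)

lemma is_subalgebra_generated:
  assumes "X \<subseteq> carrier M"
  shows "is_subalgebra R M (carrier (generated_subalgebra R M X))"
proof -
  have "subring (\<Inter>{B. is_subalgebra R M B \<and> X \<subseteq> B}) M"
    using assms is_subalgebra_carrier by (intro subring_Inter) (auto simp: is_subalgebra_def)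
  then show ?thesis by (auto simp: generated_subalgebra_def is_subalgebra_def)
qed

lemma is_subalgebra_fixed_points:
  assumes hom: "\<And>h. h \<in> H \<Longrightarrow> h \<in> ring_hom M M"
    and smult: "\<And>h a x. h \<in> H \<Longrightarrow> a \<in> carrier R \<Longrightarrow> x \<in> carrier M \<Longrightarrow> h (a \<odot>\<^bsub>M\<^esub> x) = a \<odot>\<^bsub>M\<^esub> h x"
  shows "is_subalgebra R M {x \<in> carrier M. \<forall>h\<in>H. h x = x}"
proof -
  let ?fixed = "\<lambda>h. {x \<in> carrier M. h x = x}"
  have "subring (?fixed h) M" if "h \<in> H" for h
  proof -
    interpret h: ring_hom_cring M M h
      using hom[OF that] M_cring by (intro ring_hom_cring.intro ring_hom_cring_axioms.intro)
    show ?thesis by (rule subringI) auto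
  qed
  then have "subring (\<Inter>(insert (carrier M) (?fixed ` H))) M"
    by (intro subring_Inter) (auto simp: carrier_is_subring)
  also have "\<Inter>(insert (carrier M) (?fixed ` H)) = {x \<in> carrier M. \<forall>h\<in>H. h x = x}"
    by auto
  finally show ?thesis
    unfolding is_subalgebra_def
  proof (intro conjI ballI)
    fix a x assume a: "a \<in> carrier R" and x: "x \<in> {x \<in> carrier M. \<forall>h\<in>H. h x = x}"
    then have "h (a \<odot>\<^bsub>M\<^esub> x) = a \<odot>\<^bsub>M\<^esub> x" if "h \<in> H" for h
      using smult[OF that a] that x by auto
    then show "a \<odot>\<^bsub>M\<^esub> x \<in> {x \<in> carrier M. \<forall>h\<in>H. h x = x}"
      using a x by simp
  qed
qed

end

lemma generated_subalgebra_superset: "X \<subseteq> carrier (generated_subalgebra A M X)"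
  by (auto simp: generated_subalgebra_def)

section \<open>Localization at an element\<close>

locale localization_at = cring M for M :: "('a, 'b, 'm) module_scheme" (structure) +
  fixes f :: 'b
  assumes f_closed [simp, intro]: "f \<in> carrier M"
begin

lemma powers_closed [simp]: "s \<in> powers M f \<Longrightarrow> s \<in> carrier M"
  by (auto simp: powers_def)

lemma one_in_powers [simp]: "\<one> \<in> powers M f"
  unfolding powers_def by (rule image_eqI[where x = 0]) simp_all

lemma self_in_powers: "f \<in> powers M f"
  unfolding powers_def by (rule image_eqI[where x = 1]) simp_all

lemma powers_mult_closed [simp]: "s \<in> powers M f \<Longrightarrow> t \<in> powers M f \<Longrightarrow> s \<otimes> t \<in> powers M f"
  by (auto simp: powers_def nat_pow_mult)

lemma frac_relE:
  assumes "((x, s), (y, t)) \<in> frac_rel M f"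
  obtains u where "x \<in> carrier M" "s \<in> powers M f" "y \<in> carrier M" "t \<in> powers M f"
    "u \<in> powers M f" "u \<otimes> (x \<otimes> t) = u \<otimes> (y \<otimes> s)"
  using assms by (auto simp: frac_rel_def)

lemma frac_relI:
  assumes "x \<in> carrier M" "s \<in> powers M f" "y \<in> carrier M" "t \<in> powers M f"
    "u \<in> powers M f" "u \<otimes> (x \<otimes> t) = u \<otimes> (y \<otimes> s)"
  shows "((x, s), (y, t)) \<in> frac_rel M f"
  using assms by (auto simp: frac_rel_def)

lemma equiv_frac_rel: "equiv (carrier M \<times> powers M f) (frac_rel M f)"
proof (rule equivI)
  show "frac_rel M f \<subseteq> (carrier M \<times> powers M f) \<times> (carrier M \<times> powers M f)"
    by (auto simp: frac_rel_def)
  show "refl_on (carrier M \<times> powers M f) (frac_rel M f)"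
    using one_in_powers by (auto simp: refl_on_def frac_rel_def)
  show "sym (frac_rel M f)"
    by (auto simp: sym_def frac_rel_def intro: sym)
  show "trans (frac_rel M f)"
  proof (rule transI, clarify)
    fix x s y t z r
    assume xy: "((x, s), (y, t)) \<in> frac_rel M f" and yz: "((y, t), (z, r)) \<in> frac_rel M f"
    from xy obtain u where u: "x \<in> carrier M" "s \<in> powers M f" "y \<in> carrier M" "t \<in> powers M f"
      "u \<in> powers M f" and xy_eq: "u \<otimes> (x \<otimes> t) = u \<otimes> (y \<otimes> s)" by (rule frac_relE)
    from yz obtain v where v: "z \<in> carrier M" "r \<in> powers M f" "v \<in> powers M f"
      and yz_eq: "v \<otimes> (y \<otimes> r) = v \<otimes> (z \<otimes> t)" by (rule frac_relE)
    have "u \<otimes> v \<otimes> t \<otimes> (x \<otimes> r) = v \<otimes> r \<otimes> (u \<otimes> (x \<otimes> t))" using u v by (simp add: m_ac)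
    also have "\<dots> = u \<otimes> s \<otimes> (v \<otimes> (y \<otimes> r))" unfolding xy_eq using u v by (simp add: m_ac)
    also have "\<dots> = u \<otimes> v \<otimes> t \<otimes> (z \<otimes> s)" unfolding yz_eq using u v by (simp add: m_ac)
    finally show "((x, s), (z, r)) \<in> frac_rel M f"
      using u v by (intro frac_relI[where u = "u \<otimes> v \<otimes> t"]) simp_all
  qed
qed

lemma frac_rel_mult:
  assumes "((x, s), (x', s')) \<in> frac_rel M f" and "((y, t), (y', t')) \<in> frac_rel M f"
  shows "((x \<otimes> y, s \<otimes> t), (x' \<otimes> y', s' \<otimes> t')) \<in> frac_rel M f"
proof -
  from assms(1) obtain u where
    u: "x \<in> carrier M" "s \<in> powers M f" "x' \<in> carrier M" "s' \<in> powers M f" "u \<in> powers M f"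
    and x_eq: "u \<otimes> (x \<otimes> s') = u \<otimes> (x' \<otimes> s)" by (rule frac_relE)
  from assms(2) obtain v where
    v: "y \<in> carrier M" "t \<in> powers M f" "y' \<in> carrier M" "t' \<in> powers M f" "v \<in> powers M f"
    and y_eq: "v \<otimes> (y \<otimes> t') = v \<otimes> (y' \<otimes> t)" by (rule frac_relE)
  have "u \<otimes> v \<otimes> (x \<otimes> y \<otimes> (s' \<otimes> t')) = u \<otimes> (x \<otimes> s') \<otimes> (v \<otimes> (y \<otimes> t'))"
    using u v by (simp add: m_ac)
  also have "\<dots> = u \<otimes> v \<otimes> (x' \<otimes> y' \<otimes> (s \<otimes> t))"
    unfolding x_eq y_eq using u v by (simp add: m_ac)
  finally show ?thesis
    using u v by (intro frac_relI[where u = "u \<otimes> v"]) simp_all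
qed

lemma frac_rel_add:
  assumes "((x, s), (x', s')) \<in> frac_rel M f" and "((y, t), (y', t')) \<in> frac_rel M f"
  shows "((x \<otimes> t \<oplus> y \<otimes> s, s \<otimes> t), (x' \<otimes> t' \<oplus> y' \<otimes> s', s' \<otimes> t')) \<in> frac_rel M f"
proof -
  from assms(1) obtain u where
    u: "x \<in> carrier M" "s \<in> powers M f" "x' \<in> carrier M" "s' \<in> powers M f" "u \<in> powers M f"
    and x_eq: "u \<otimes> (x \<otimes> s') = u \<otimes> (x' \<otimes> s)" by (rule frac_relE)
  from assms(2) obtain v where
    v: "y \<in> carrier M" "t \<in> powers M f" "y' \<in> carrier M" "t' \<in> powers M f" "v \<in> powers M f"
    and y_eq: "v \<otimes> (y \<otimes> t') = v \<otimes> (y' \<otimes> t)" by (rule frac_relE)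
  have "u \<otimes> v \<otimes> ((x \<otimes> t \<oplus> y \<otimes> s) \<otimes> (s' \<otimes> t')) =
      (v \<otimes> t \<otimes> t') \<otimes> (u \<otimes> (x \<otimes> s')) \<oplus> (u \<otimes> s \<otimes> s') \<otimes> (v \<otimes> (y \<otimes> t'))"
    using u v by (simp add: m_ac l_distr r_distr)
  also have "\<dots> = u \<otimes> v \<otimes> ((x' \<otimes> t' \<oplus> y' \<otimes> s') \<otimes> (s \<otimes> t))"
    unfolding x_eq y_eq using u v by (simp add: m_ac l_distr r_distr)
  finally show ?thesis
    using u v by (intro frac_relI[where u = "u \<otimes> v"]) simp_all
qed

lemma frac_rel_smult:
  assumes "algebra A M" "a \<in> carrier A" "((x, s), (y, t)) \<in> frac_rel M f"
  shows "((a \<odot> x, s), (a \<odot> y, t)) \<in> frac_rel M f"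
proof -
  interpret A: algebra A M by fact
  from assms(3) obtain u where
    u: "x \<in> carrier M" "s \<in> powers M f" "y \<in> carrier M" "t \<in> powers M f" "u \<in> powers M f"
    and eq: "u \<otimes> (x \<otimes> t) = u \<otimes> (y \<otimes> s)" by (rule frac_relE)
  have smult_out: "u \<otimes> ((a \<odot> w) \<otimes> r) = a \<odot> (u \<otimes> (w \<otimes> r))" if "w \<in> carrier M" "r \<in> powers M f" for w r
    using that u assms(2) by (simp add: A.smult_assoc2 m_comm[of u])
  show ?thesis
    using u assms(2) eq by (intro frac_relI[where u = u]) (simp_all add: smult_out)
qed

definition fraction :: "'b \<Rightarrow> 'b \<Rightarrow> ('b \<times> 'b) set"
  where "fraction x s = frac_rel M f `` {(x, s)}"

lemma fraction_eq_iff: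
  assumes "x \<in> carrier M" "s \<in> powers M f" "y \<in> carrier M" "t \<in> powers M f"
  shows "fraction x s = fraction y t \<longleftrightarrow> (\<exists>u\<in>powers M f. u \<otimes> (x \<otimes> t) = u \<otimes> (y \<otimes> s))"
  unfolding fraction_def using eq_equiv_class_iff[OF equiv_frac_rel, of "(x, s)" "(y, t)"] assms
  by (simp add: frac_rel_def)

lemma fraction_eqI: "((x, s), (y, t)) \<in> frac_rel M f \<Longrightarrow> fraction x s = fraction y t"
  unfolding fraction_def by (rule equiv_class_eq[OF equiv_frac_rel])

lemma fraction_closed:
  "x \<in> carrier M \<Longrightarrow> s \<in> powers M f \<Longrightarrow> fraction x s \<in> carrier (localization M f)"
  by (simp add: fraction_def localization_def quotientI)

lemma localization_cases [cases set]:
  assumes "X \<in> carrier (localization M f)"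
  obtains x s where "X = fraction x s" "x \<in> carrier M" "s \<in> powers M f"
  using assms by (auto simp: fraction_def localization_def elim!: quotientE)

lemma localization_one: "\<one>\<^bsub>localization M f\<^esub> = fraction \<one> \<one>"
  by (simp add: fraction_def localization_def)

lemma localization_mult:
  assumes "x \<in> carrier M" "s \<in> powers M f" "y \<in> carrier M" "t \<in> powers M f"
  shows "fraction x s \<otimes>\<^bsub>localization M f\<^esub> fraction y t = fraction (x \<otimes> y) (s \<otimes> t)"
proof -
  have "congruent2 (frac_rel M f) (frac_rel M f)
      (\<lambda>p q. fraction (fst p \<otimes> fst q) (snd p \<otimes> snd q))"
    by (auto intro!: congruent2I' fraction_eqI frac_rel_mult)
  from UN_equiv_class2[OF equiv_frac_rel equiv_frac_rel this, of "(x, s)" "(y, t)"] assms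
  show ?thesis by (simp add: localization_def fraction_def split_def)
qed

lemma localization_add:
  assumes "x \<in> carrier M" "s \<in> powers M f" "y \<in> carrier M" "t \<in> powers M f"
  shows "fraction x s \<oplus>\<^bsub>localization M f\<^esub> fraction y t = fraction (x \<otimes> t \<oplus> y \<otimes> s) (s \<otimes> t)"
proof -
  have "congruent2 (frac_rel M f) (frac_rel M f)
      (\<lambda>p q. fraction (fst p \<otimes> snd q \<oplus> fst q \<otimes> snd p) (snd p \<otimes> snd q))"
    by (auto intro!: congruent2I' fraction_eqI frac_rel_add)
  from UN_equiv_class2[OF equiv_frac_rel equiv_frac_rel this, of "(x, s)" "(y, t)"] assms
  show ?thesis by (simp add: localization_def fraction_def split_def)
qed

lemma localization_smult:
  assumes "algebra A M" "a \<in> carrier A" "x \<in> carrier M" "s \<in> powers M f"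
  shows "a \<odot>\<^bsub>localization M f\<^esub> fraction x s = fraction (a \<odot> x) s"
proof -
  have "congruent (frac_rel M f) (\<lambda>p. fraction (a \<odot> fst p) (snd p))"
    by (auto intro!: congruentI fraction_eqI frac_rel_smult[OF assms(1,2)])
  from UN_equiv_class[OF equiv_frac_rel this, of "(x, s)"] assms(3,4)
  show ?thesis by (simp add: localization_def fraction_def split_def)
qed

end

locale localization_hom = ring_hom_cring M N h
  for M :: "('a, 'b, 'm) module_scheme" and N :: "('a, 'c, 'l) module_scheme" and h +
  fixes f :: 'b
  assumes element_closed: "f \<in> carrier M"
begin

sublocale source: localization_at M f
  by unfold_locales (rule element_closed)

sublocale target: localization_at N "h f"
  by unfold_locales (simp add: element_closed)

lemma powers_image: "powers N (h f) = h ` powers M f"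
proof -
  have "h f [^]\<^bsub>N\<^esub> k = h (f [^]\<^bsub>M\<^esub> k)" for k :: nat
    by (induction k) (simp_all add: element_closed)
  then show ?thesis by (simp add: powers_def image_image)
qed

lemma hom_powers [simp]: "s \<in> powers M f \<Longrightarrow> h s \<in> powers N (h f)"
  by (simp add: powers_image)

lemma fraction_hom_cong:
  assumes "((x, s), (y, t)) \<in> frac_rel M f"
  shows "target.fraction (h x) (h s) = target.fraction (h y) (h t)"
proof -
  from assms obtain u where
    u: "x \<in> carrier M" "s \<in> powers M f" "y \<in> carrier M" "t \<in> powers M f" "u \<in> powers M f"
    and "u \<otimes>\<^bsub>M\<^esub> (x \<otimes>\<^bsub>M\<^esub> t) = u \<otimes>\<^bsub>M\<^esub> (y \<otimes>\<^bsub>M\<^esub> s)" by (rule source.frac_relE)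
  then have "h u \<otimes>\<^bsub>N\<^esub> (h x \<otimes>\<^bsub>N\<^esub> h t) = h u \<otimes>\<^bsub>N\<^esub> (h y \<otimes>\<^bsub>N\<^esub> h s)"
    by (metis hom_mult source.powers_closed R.m_closed)
  then show ?thesis
    using u by (intro target.fraction_eqI target.frac_relI[where u = "h u"]) simp_all
qed

lemma localization_map_fraction:
  assumes "x \<in> carrier M" "s \<in> powers M f"
  shows "localization_map h N f (source.fraction x s) = target.fraction (h x) (h s)"
proof -
  have "congruent (frac_rel M f) (\<lambda>p. target.fraction (h (fst p)) (h (snd p)))"
    by (auto intro!: congruentI fraction_hom_cong)
  from UN_equiv_class[OF source.equiv_frac_rel this, of "(x, s)"] assms
  show ?thesis
    by (simp add: localization_map_def source.fraction_def target.fraction_def split_def)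
qed

lemma localization_map_ring_hom:
  "localization_map h N f \<in> ring_hom (localization M f) (localization N (h f))"
proof (rule ring_hom_memI)
  fix X assume "X \<in> carrier (localization M f)"
  then show "localization_map h N f X \<in> carrier (localization N (h f))"
    by (cases rule: source.localization_cases)
      (simp add: localization_map_fraction target.fraction_closed)
next
  fix X Y assume "X \<in> carrier (localization M f)" "Y \<in> carrier (localization M f)"
  then obtain x s y t where X: "X = source.fraction x s" "x \<in> carrier M" "s \<in> powers M f"
    and Y: "Y = source.fraction y t" "y \<in> carrier M" "t \<in> powers M f"
    by (elim source.localization_cases)
  show "localization_map h N f (X \<otimes>\<^bsub>localization M f\<^esub> Y) =
      localization_map h N f X \<otimes>\<^bsub>localization N (h f)\<^esub> localization_map h N f Y"
    using X Y
    by (simp add: localization_map_fraction source.localization_mult target.localization_mult)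
  show "localization_map h N f (X \<oplus>\<^bsub>localization M f\<^esub> Y) =
      localization_map h N f X \<oplus>\<^bsub>localization N (h f)\<^esub> localization_map h N f Y"
    using X Y
    by (simp add: localization_map_fraction source.localization_add target.localization_add)
next
  show "localization_map h N f \<one>\<^bsub>localization M f\<^esub> = \<one>\<^bsub>localization N (h f)\<^esub>"
    by (simp add: source.localization_one target.localization_one localization_map_fraction)
qed

lemma localization_map_inj_on:
  assumes kernel: "\<And>x. x \<in> carrier M \<Longrightarrow> h x = \<zero>\<^bsub>N\<^esub> \<Longrightarrow> \<exists>s\<in>powers M f. s \<otimes>\<^bsub>M\<^esub> x = \<zero>\<^bsub>M\<^esub>"
  shows "inj_on (localization_map h N f) (carrier (localization M f))"
proof (rule inj_onI)
  fix X Y assume "X \<in> carrier (localization M f)" "Y \<in> carrier (localization M f)"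
    and eq: "localization_map h N f X = localization_map h N f Y"
  then obtain x s y t where X: "X = source.fraction x s" "x \<in> carrier M" "s \<in> powers M f"
    and Y: "Y = source.fraction y t" "y \<in> carrier M" "t \<in> powers M f"
    by (elim source.localization_cases)
  obtain u where u: "u \<in> powers M f"
    and "h u \<otimes>\<^bsub>N\<^esub> (h x \<otimes>\<^bsub>N\<^esub> h t) = h u \<otimes>\<^bsub>N\<^esub> (h y \<otimes>\<^bsub>N\<^esub> h s)"
    using eq X Y by (auto simp: localization_map_fraction target.fraction_eq_iff powers_image)
  let ?xt = "u \<otimes>\<^bsub>M\<^esub> (x \<otimes>\<^bsub>M\<^esub> t)" and ?ys = "u \<otimes>\<^bsub>M\<^esub> (y \<otimes>\<^bsub>M\<^esub> s)"
  have closed: "?xt \<in> carrier M" "?ys \<in> carrier M" using X Y u by simp_all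
  have "h ?xt = h ?ys"
    using X Y u \<open>h u \<otimes>\<^bsub>N\<^esub> (h x \<otimes>\<^bsub>N\<^esub> h t) = h u \<otimes>\<^bsub>N\<^esub> (h y \<otimes>\<^bsub>N\<^esub> h s)\<close> by simp
  then have "h (?xt \<ominus>\<^bsub>M\<^esub> ?ys) = \<zero>\<^bsub>N\<^esub>"
    using closed by (simp add: R.minus_eq S.r_neg del: hom_mult)
  then obtain v where v: "v \<in> powers M f" "v \<otimes>\<^bsub>M\<^esub> (?xt \<ominus>\<^bsub>M\<^esub> ?ys) = \<zero>\<^bsub>M\<^esub>"
    using kernel closed by blast
  then have "v \<otimes>\<^bsub>M\<^esub> ?xt \<ominus>\<^bsub>M\<^esub> v \<otimes>\<^bsub>M\<^esub> ?ys = \<zero>\<^bsub>M\<^esub>"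
    using closed by (simp add: R.minus_eq R.r_distr R.r_minus)
  then have "v \<otimes>\<^bsub>M\<^esub> ?xt = v \<otimes>\<^bsub>M\<^esub> ?ys"
    using closed v by (simp add: R.r_right_minus_eq)
  then have "v \<otimes>\<^bsub>M\<^esub> u \<otimes>\<^bsub>M\<^esub> (x \<otimes>\<^bsub>M\<^esub> t) = v \<otimes>\<^bsub>M\<^esub> u \<otimes>\<^bsub>M\<^esub> (y \<otimes>\<^bsub>M\<^esub> s)"
    using X Y u v by (simp add: R.m_assoc)
  then show "X = Y"
    using X Y u v by (auto simp: source.fraction_eq_iff intro!: bexI[where x = "v \<otimes>\<^bsub>M\<^esub> u"])
qed

lemma localization_map_surj:
  assumes image: "\<And>y. y \<in> carrier N \<Longrightarrow> \<exists>s\<in>powers M f. h s \<otimes>\<^bsub>N\<^esub> y \<in> h ` carrier M"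
  shows "localization_map h N f ` carrier (localization M f) = carrier (localization N (h f))"
proof (intro equalityI subsetI)
  fix Y assume "Y \<in> carrier (localization N (h f))"
  then obtain y t where Y: "Y = target.fraction y (h t)" "y \<in> carrier N" "t \<in> powers M f"
    by (cases rule: target.localization_cases) (auto simp: powers_image)
  obtain s x where s: "s \<in> powers M f" and x: "x \<in> carrier M" "h s \<otimes>\<^bsub>N\<^esub> y = h x"
    using image[OF Y(2)] by blast
  have "y \<otimes>\<^bsub>N\<^esub> h (s \<otimes>\<^bsub>M\<^esub> t) = (h s \<otimes>\<^bsub>N\<^esub> y) \<otimes>\<^bsub>N\<^esub> h t"
    using Y s by (simp add: S.m_ac)
  then have "Y = target.fraction (h x) (h (s \<otimes>\<^bsub>M\<^esub> t))"
    unfolding Y(1) using Y s x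
    by (intro target.fraction_eqI target.frac_relI[where u = "\<one>\<^bsub>N\<^esub>"]) (simp_all del: hom_mult)
  then have "Y = localization_map h N f (source.fraction x (s \<otimes>\<^bsub>M\<^esub> t))"
    using Y s x by (simp add: localization_map_fraction)
  then show "Y \<in> localization_map h N f ` carrier (localization M f)"
    using Y s x by (simp add: source.fraction_closed)
qed (auto intro: ring_hom_closed[OF localization_map_ring_hom])

lemma localization_map_algebra_iso:
  assumes M: "algebra A M" and N: "algebra A N"
    and smult: "\<And>a x. a \<in> carrier A \<Longrightarrow> x \<in> carrier M \<Longrightarrow> h (a \<odot>\<^bsub>M\<^esub> x) = a \<odot>\<^bsub>N\<^esub> h x"
    and kernel: "\<And>x. x \<in> carrier M \<Longrightarrow> h x = \<zero>\<^bsub>N\<^esub> \<Longrightarrow> \<exists>s\<in>powers M f. s \<otimes>\<^bsub>M\<^esub> x = \<zero>\<^bsub>M\<^esub>"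
    and image: "\<And>y. y \<in> carrier N \<Longrightarrow> \<exists>s\<in>powers M f. h s \<otimes>\<^bsub>N\<^esub> y \<in> h ` carrier M"
  shows "localization_map h N f \<in> algebra_iso A (localization M f) (localization N (h f))"
proof -
  interpret M: algebra A M by fact
  have "localization_map h N f (a \<odot>\<^bsub>localization M f\<^esub> X) =
      a \<odot>\<^bsub>localization N (h f)\<^esub> localization_map h N f X"
    if a: "a \<in> carrier A" and X: "X \<in> carrier (localization M f)" for a X
    using X a
    by (cases rule: source.localization_cases)
      (simp add: localization_map_fraction source.localization_smult[OF M]
        target.localization_smult[OF N] smult)
  then show ?thesis
    using localization_map_ring_hom localization_map_inj_on[OF kernel]
      localization_map_surj[OF image]
    by (simp add: algebra_iso_def ring_iso_def bij_betw_def)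
qed

end

lemma localization_map_subalgebra_iso:
  assumes M: "algebra A M" and B: "is_subalgebra A M B" and f: "f \<in> B"
    and absorb: "\<And>t. t \<in> carrier M \<Longrightarrow> f \<otimes>\<^bsub>M\<^esub> t \<in> B"
  shows "localization_map (\<lambda>t. t) M f \<in>
    algebra_iso A (localization (M\<lparr>carrier := B\<rparr>) f) (localization M f)"
proof -
  interpret M: algebra A M by fact
  have alg: "algebra A (M\<lparr>carrier := B\<rparr>)" using B by (rule M.algebra_subalgebra)
  have "B \<subseteq> carrier M" using B subringE(1) unfolding is_subalgebra_def by blast
  then have incl: "(\<lambda>t. t) \<in> ring_hom (M\<lparr>carrier := B\<rparr>) M" by (auto simp: ring_hom_def)
  interpret localization_hom "M\<lparr>carrier := B\<rparr>" M "\<lambda>t. t" f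
    using algebra.M_cring[OF alg] M.M_cring incl f
    by (intro localization_hom.intro localization_hom_axioms.intro ring_hom_cring.intro
        ring_hom_cring_axioms.intro) simp_all
  show ?thesis
  proof (rule localization_map_algebra_iso[OF alg M])
    fix t assume "t \<in> carrier M"
    then show "\<exists>s\<in>powers (M\<lparr>carrier := B\<rparr>) f. s \<otimes>\<^bsub>M\<^esub> t \<in> (\<lambda>t. t) ` carrier (M\<lparr>carrier := B\<rparr>)"
      using source.self_in_powers absorb by auto
  next
    fix t assume "t \<in> carrier (M\<lparr>carrier := B\<rparr>)" "t = \<zero>\<^bsub>M\<^esub>"
    then show "\<exists>s\<in>powers (M\<lparr>carrier := B\<rparr>) f.
        s \<otimes>\<^bsub>M\<lparr>carrier := B\<rparr>\<^esub> t = \<zero>\<^bsub>M\<lparr>carrier := B\<rparr>\<^esub>"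
      using source.one_in_powers by (intro bexI[where x = "\<one>\<^bsub>M\<^esub>"]) simp_all
  qed simp
qed

section \<open>Generated ideals and quotient rings\<close>

lemma (in group_hom) generate_image_subset:
  assumes "K \<subseteq> carrier G" "L \<subseteq> carrier H" "h ` K \<subseteq> generate H L"
  shows "h ` generate G K \<subseteq> generate H L"
  using generate_img[OF assms(1)] H.generate_subgroup_incl[OF assms(3) H.generate_is_subgroup]
    assms(2) by simp

lemma (in cring) ideal_generate:
  assumes S: "S \<subseteq> carrier R"
    and absorb: "\<And>c r. c \<in> carrier R \<Longrightarrow> r \<in> S \<Longrightarrow> c \<otimes> r \<in> generate (add_monoid R) S"
  shows "ideal (generate (add_monoid R) S) R"
proof (rule idealI[OF ring_axioms])
  show "subgroup (generate (add_monoid R) S) (add_monoid R)"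
    using S by (intro add.generate_is_subgroup) simp
  fix x c assume x: "x \<in> generate (add_monoid R) S" and c: "c \<in> carrier R"
  interpret mult_c: group_hom "add_monoid R" "add_monoid R" "\<lambda>x. c \<otimes> x"
    using c by unfold_locales (auto simp: hom_def r_distr)
  show "c \<otimes> x \<in> generate (add_monoid R) S"
    using mult_c.generate_image_subset[of S S] S absorb[OF c] x by auto
  then show "x \<otimes> c \<in> generate (add_monoid R) S"
    using x c add.generate_incl[of S] S by (simp add: m_comm subset_eq)
qed

lemma (in ring) image_a_r_coset:
  assumes "h \<in> ring_hom R S" "I \<subseteq> carrier R" "c \<in> carrier R"
  shows "h ` (I +> c) = h ` I +>\<^bsub>S\<^esub> h c"
  using assms by (force simp: a_r_coset_def' ring_hom_add)

lemma image_ring_hom_Quot: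
  assumes I: "ideal I R" and J: "ideal J S" and h: "h \<in> ring_hom R S" and "h ` I = J"
  shows "(\<lambda>X. h ` X) \<in> ring_hom (R Quot I) (S Quot J)"
proof -
  interpret I: ideal I R by fact
  interpret J: ideal J S by fact
  have coset: "h ` (I +>\<^bsub>R\<^esub> c) = J +>\<^bsub>S\<^esub> h c" if "c \<in> carrier R" for c
    using I.image_a_r_coset[OF h _ that] I.a_subset \<open>h ` I = J\<close> by simp
  note proj = I.rcos_ring_hom J.rcos_ring_hom
  show ?thesis
  proof (rule ring_hom_memI)
    fix X assume "X \<in> carrier (R Quot I)"
    then obtain c where "c \<in> carrier R" "X = I +>\<^bsub>R\<^esub> c"
      by (auto simp: FactRing_def A_RCOSETS_def')
    then show "h ` X \<in> carrier (S Quot J)"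
      using ring_hom_closed[OF proj(2) ring_hom_closed[OF h]] coset by simp
  next
    fix X Y assume "X \<in> carrier (R Quot I)" "Y \<in> carrier (R Quot I)"
    then obtain c d where c: "c \<in> carrier R" "X = I +>\<^bsub>R\<^esub> c" and d: "d \<in> carrier R" "Y = I +>\<^bsub>R\<^esub> d"
      by (auto simp: FactRing_def A_RCOSETS_def')
    show "h ` (X \<otimes>\<^bsub>R Quot I\<^esub> Y) = h ` X \<otimes>\<^bsub>S Quot J\<^esub> h ` Y"
      using c d h by (simp add: coset ring_hom_closed flip: ring_hom_mult[OF proj(1)]
        ring_hom_mult[OF proj(2)]) (simp add: coset ring_hom_mult)
    show "h ` (X \<oplus>\<^bsub>R Quot I\<^esub> Y) = h ` X \<oplus>\<^bsub>S Quot J\<^esub> h ` Y"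
      using c d h by (simp add: coset ring_hom_closed flip: ring_hom_add[OF proj(1)]
        ring_hom_add[OF proj(2)]) (simp add: coset ring_hom_add)
  next
    show "h ` \<one>\<^bsub>R Quot I\<^esub> = \<one>\<^bsub>S Quot J\<^esub>"
      using coset[of "\<one>\<^bsub>R\<^esub>"] h by (simp add: FactRing_def ring_hom_one)
  qed
qed

section \<open>Integral monoid rings\<close>

lemma frag_extend_fun_diff:
  "frag_extend (\<lambda>x. f x - g x) c = frag_extend f c - frag_extend g c"
  using subset_UNIV[of "Poly_Mapping.keys c"]
  by (induction c rule: frag_induction) (auto simp: frag_extend_diff)

definition monoid_ring :: "('g, 'm) monoid_scheme \<Rightarrow> ('g \<Rightarrow>\<^sub>0 int) ring"
  where "monoid_ring G =
    \<lparr>carrier = {c. Poly_Mapping.keys c \<subseteq> carrier G},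
     mult = (\<lambda>c d. frag_extend (\<lambda>x. frag_extend (\<lambda>y. frag_of (x \<otimes>\<^bsub>G\<^esub> y)) d) c),
     one = frag_of \<one>\<^bsub>G\<^esub>,
     zero = 0,
     add = (+)\<rparr>"

lemma mem_carrier_monoid_ring: "c \<in> carrier (monoid_ring G) \<longleftrightarrow> Poly_Mapping.keys c \<subseteq> carrier G"
  by (simp add: monoid_ring_def)

lemma monoid_ring_simps:
  shows monoid_ring_zero: "\<zero>\<^bsub>monoid_ring G\<^esub> = 0"
    and monoid_ring_one: "\<one>\<^bsub>monoid_ring G\<^esub> = frag_of \<one>\<^bsub>G\<^esub>"
    and monoid_ring_add: "c \<oplus>\<^bsub>monoid_ring G\<^esub> d = c + d"
  by (simp_all add: monoid_ring_def)

lemma monoid_ring_mult_simps: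
  shows monoid_ring_mult_of: "frag_of x \<otimes>\<^bsub>monoid_ring G\<^esub> frag_of y = frag_of (x \<otimes>\<^bsub>G\<^esub> y)"
    and monoid_ring_zero_mult: "0 \<otimes>\<^bsub>monoid_ring G\<^esub> c = 0"
    and monoid_ring_mult_zero: "c \<otimes>\<^bsub>monoid_ring G\<^esub> 0 = 0"
    and monoid_ring_diff_mult:
      "(c - d) \<otimes>\<^bsub>monoid_ring G\<^esub> e = c \<otimes>\<^bsub>monoid_ring G\<^esub> e - d \<otimes>\<^bsub>monoid_ring G\<^esub> e"
    and monoid_ring_mult_diff:
      "e \<otimes>\<^bsub>monoid_ring G\<^esub> (c - d) = e \<otimes>\<^bsub>monoid_ring G\<^esub> c - e \<otimes>\<^bsub>monoid_ring G\<^esub> d"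
  by (simp_all add: monoid_ring_def frag_extend_eq_0 frag_extend_diff frag_extend_fun_diff)

lemma monoid_ring_closed:
  shows monoid_ring_zero_closed: "0 \<in> carrier (monoid_ring G)"
    and monoid_ring_of_closed: "x \<in> carrier G \<Longrightarrow> frag_of x \<in> carrier (monoid_ring G)"
    and monoid_ring_diff_closed:
      "c \<in> carrier (monoid_ring G) \<Longrightarrow> d \<in> carrier (monoid_ring G) \<Longrightarrow>
        c - d \<in> carrier (monoid_ring G)"
  using keys_diff[of c d] by (auto simp: mem_carrier_monoid_ring)

lemma monoid_ring_induct [consumes 1, case_names zero of diff]:
  assumes "c \<in> carrier (monoid_ring G)" "Q 0" "\<And>x. x \<in> carrier G \<Longrightarrow> Q (frag_of x)"
    "\<And>c d. Q c \<Longrightarrow> Q d \<Longrightarrow> Q (c - d)"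
  shows "Q c"
  using assms(1) unfolding mem_carrier_monoid_ring
  by (induction c rule: frag_induction) (use assms in auto)

context comm_monoid
begin

abbreviation "\<Z>G \<equiv> monoid_ring G"

lemma monoid_ring_mult_closed:
  assumes "c \<in> carrier \<Z>G" "d \<in> carrier \<Z>G"
  shows "c \<otimes>\<^bsub>\<Z>G\<^esub> d \<in> carrier \<Z>G"
  using assms(1)
proof (induction rule: monoid_ring_induct)
  case (of x)
  show ?case
    using assms(2) of
    by (induction rule: monoid_ring_induct) (simp_all add: monoid_ring_mult_simps monoid_ring_closed)
qed (simp_all add: monoid_ring_mult_simps monoid_ring_closed)

lemma monoid_ring_mult_comm:
  assumes "c \<in> carrier \<Z>G" "d \<in> carrier \<Z>G"
  shows "c \<otimes>\<^bsub>\<Z>G\<^esub> d = d \<otimes>\<^bsub>\<Z>G\<^esub> c"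
  using assms(1)
proof (induction rule: monoid_ring_induct)
  case (of x)
  show ?case
    using assms(2) of
    by (induction rule: monoid_ring_induct) (simp_all add: monoid_ring_mult_simps m_comm)
qed (simp_all add: monoid_ring_mult_simps)

lemma monoid_ring_mult_assoc:
  assumes "c \<in> carrier \<Z>G" "d \<in> carrier \<Z>G" "e \<in> carrier \<Z>G"
  shows "(c \<otimes>\<^bsub>\<Z>G\<^esub> d) \<otimes>\<^bsub>\<Z>G\<^esub> e = c \<otimes>\<^bsub>\<Z>G\<^esub> (d \<otimes>\<^bsub>\<Z>G\<^esub> e)"
  using assms(1)
proof (induction rule: monoid_ring_induct)
  case x: (of x)
  show ?case
    using assms(2)
  proof (induction rule: monoid_ring_induct)
    case y: (of y)
    show ?case
      using assms(3) x y
      by (induction rule: monoid_ring_induct) (simp_all add: monoid_ring_mult_simps m_assoc)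
  qed (simp_all add: monoid_ring_mult_simps)
qed (simp_all add: monoid_ring_mult_simps)

lemma monoid_ring_one_mult:
  assumes "c \<in> carrier \<Z>G"
  shows "\<one>\<^bsub>\<Z>G\<^esub> \<otimes>\<^bsub>\<Z>G\<^esub> c = c"
  using assms
  by (induction rule: monoid_ring_induct) (simp_all add: monoid_ring_mult_simps monoid_ring_one)

lemma cring_monoid_ring: "cring \<Z>G"
proof (rule cringI)
  show "abelian_group \<Z>G"
  proof (rule abelian_groupI)
    fix c assume "c \<in> carrier \<Z>G"
    then show "\<exists>d\<in>carrier \<Z>G. d \<oplus>\<^bsub>\<Z>G\<^esub> c = \<zero>\<^bsub>\<Z>G\<^esub>"
      by (intro bexI[where x = "- c"]) (auto simp: mem_carrier_monoid_ring monoid_ring_simps)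
  next
    fix c d assume "c \<in> carrier \<Z>G" "d \<in> carrier \<Z>G"
    then show "c \<oplus>\<^bsub>\<Z>G\<^esub> d \<in> carrier \<Z>G"
      using keys_add[of c d] by (auto simp: mem_carrier_monoid_ring monoid_ring_add)
  qed (simp_all add: monoid_ring_simps monoid_ring_closed add_ac)
  show "Group.comm_monoid \<Z>G"
    by (intro comm_monoidI monoid_ring_mult_closed monoid_ring_mult_assoc monoid_ring_one_mult
        monoid_ring_mult_comm) (simp_all add: monoid_ring_one monoid_ring_closed)
  show "(c \<oplus>\<^bsub>\<Z>G\<^esub> d) \<otimes>\<^bsub>\<Z>G\<^esub> e = c \<otimes>\<^bsub>\<Z>G\<^esub> e \<oplus>\<^bsub>\<Z>G\<^esub> d \<otimes>\<^bsub>\<Z>G\<^esub> e" for c d e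
    using monoid_ring_diff_mult[of G "c + d" d e] by (simp add: monoid_ring_simps)
qed

interpretation monoid_ring: cring \<Z>G
  by (rule cring_monoid_ring)

lemma monoid_ring_minus: "c \<in> carrier \<Z>G \<Longrightarrow> \<ominus>\<^bsub>\<Z>G\<^esub> c = - c"
  by (rule monoid_ring.minus_equality) (auto simp: mem_carrier_monoid_ring monoid_ring_simps)

lemma monoid_ring_minus_eq_diff:
  "c \<in> carrier \<Z>G \<Longrightarrow> d \<in> carrier \<Z>G \<Longrightarrow> c \<ominus>\<^bsub>\<Z>G\<^esub> d = c - d"
  by (simp add: a_minus_def monoid_ring_minus monoid_ring_simps)

lemma monoid_ring_subgroup_diff:
  assumes "subgroup J (add_monoid \<Z>G)" "c \<in> J" "d \<in> J"
  shows "c - d \<in> J"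
proof -
  have "J \<subseteq> carrier \<Z>G" using subgroup.subset[OF assms(1)] by simp
  then have "- d \<in> J"
    using subgroup.m_inv_closed[OF assms(1,3)] assms(3) monoid_ring_minus[of d]
    by (auto simp: a_inv_def)
  then show ?thesis
    using subgroup.m_closed[OF assms(1,2), of "- d"] by (simp add: monoid_ring_simps)
qed

lemma ideal_generate_monoid_ring:
  assumes S: "S \<subseteq> carrier \<Z>G"
    and absorb: "\<And>x r. x \<in> carrier G \<Longrightarrow> r \<in> S \<Longrightarrow> frag_of x \<otimes>\<^bsub>\<Z>G\<^esub> r \<in> generate (add_monoid \<Z>G) S"
  shows "ideal (generate (add_monoid \<Z>G) S) \<Z>G"
proof (rule monoid_ring.ideal_generate[OF S])
  let ?J = "generate (add_monoid \<Z>G) S"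
  have J: "subgroup ?J (add_monoid \<Z>G)"
    using S by (intro monoid_ring.add.generate_is_subgroup) simp
  fix c r assume "c \<in> carrier \<Z>G" and r: "r \<in> S"
  from this(1) show "c \<otimes>\<^bsub>\<Z>G\<^esub> r \<in> ?J"
  proof (induction rule: monoid_ring_induct)
    case zero
    have "\<zero>\<^bsub>\<Z>G\<^esub> \<in> ?J" using subgroup.one_closed[OF J] by simp
    then show ?case by (simp only: monoid_ring_zero monoid_ring_zero_mult)
  next
    case (of x)
    show ?case using of r by (rule absorb)
  next
    case (diff c d)
    then show ?case using monoid_ring_subgroup_diff[OF J] by (simp add: monoid_ring_mult_simps)
  qed
qed

end

lemma monoid_ring_map_hom:
  assumes \<phi>: "\<phi> \<in> hom G H" "\<phi> \<one>\<^bsub>G\<^esub> = \<one>\<^bsub>H\<^esub>"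
  shows "frag_extend (\<lambda>x. frag_of (\<phi> x)) \<in> ring_hom (monoid_ring G) (monoid_ring H)"
    (is "?map \<in> _")
proof (rule ring_hom_memI)
  fix c assume c: "c \<in> carrier (monoid_ring G)"
  then show "?map c \<in> carrier (monoid_ring H)"
    by (induction rule: monoid_ring_induct)
      (use \<phi>(1) in \<open>simp_all add: frag_extend_diff monoid_ring_closed hom_in_carrier\<close>)
  fix d assume d: "d \<in> carrier (monoid_ring G)"
  show "?map (c \<oplus>\<^bsub>monoid_ring G\<^esub> d) = ?map c \<oplus>\<^bsub>monoid_ring H\<^esub> ?map d"
    by (simp add: monoid_ring_simps frag_extend_add)
  show "?map (c \<otimes>\<^bsub>monoid_ring G\<^esub> d) = ?map c \<otimes>\<^bsub>monoid_ring H\<^esub> ?map d"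
    using c
  proof (induction rule: monoid_ring_induct)
    case (of x)
    show ?case
      using d of \<phi>
      by (induction rule: monoid_ring_induct)
        (simp_all add: monoid_ring_mult_simps frag_extend_diff hom_mult)
  qed (simp_all add: monoid_ring_mult_simps frag_extend_diff)
qed (simp add: monoid_ring_simps \<phi>)

section \<open>Tensor powers of an algebra\<close>

definition tuple_monoid :: "('b, 'm) ring_scheme \<Rightarrow> nat \<Rightarrow> (nat \<Rightarrow> 'b) monoid"
  where "tuple_monoid R n =
    \<lparr>carrier = tuples R n, mult = tuple_mult R n, one = (\<lambda>i\<in>{..<n}. \<one>\<^bsub>R\<^esub>)\<rparr>"

lemma tuple_monoid_simps:
  "carrier (tuple_monoid R n) = tuples R n"
  "x \<otimes>\<^bsub>tuple_monoid R n\<^esub> y = tuple_mult R n x y"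
  "\<one>\<^bsub>tuple_monoid R n\<^esub> = (\<lambda>i\<in>{..<n}. \<one>\<^bsub>R\<^esub>)"
  by (simp_all add: tuple_monoid_def)

lemma tuple_ring_eq_monoid_ring: "tuple_ring R n = monoid_ring (tuple_monoid R n)"
  by (simp add: tuple_ring_def monoid_ring_def tuple_monoid_simps)

lemma tuple_closed: "x \<in> tuples R n \<Longrightarrow> i < n \<Longrightarrow> x i \<in> carrier R"
  by (auto simp: tuples_def)

lemma tuple_upd_closed:
  "x \<in> tuples R n \<Longrightarrow> i < n \<Longrightarrow> u \<in> carrier R \<Longrightarrow> x(i := u) \<in> tuples R n"
  by (auto simp: tuples_def PiE_def extensional_def)

lemma restrict_in_tuples: "x \<in> {..<n} \<rightarrow> carrier R \<Longrightarrow> restrict x {..<n} \<in> tuples R n"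
  by (auto simp: tuples_def)

lemma tuple_mult_upd:
  "i < n \<Longrightarrow> tuple_mult R n x (y(i := u)) = (tuple_mult R n x y)(i := x i \<otimes>\<^bsub>R\<^esub> u)"
  by (auto simp: tuple_mult_def)

lemma (in cring) comm_monoid_tuple_monoid: "comm_monoid (tuple_monoid R n)"
  by (rule comm_monoidI)
    (auto simp: tuple_monoid_simps tuples_def tuple_mult_def PiE_def extensional_def Pi_def
      fun_eq_iff m_ac)

lemma permutes_lessThan: "\<sigma> permutes {..<n} \<Longrightarrow> i < n \<Longrightarrow> \<sigma> i < n" for n :: nat
  using permutes_in_image[of \<sigma> "{..<n}" i] by simp

lemma restrict_comp_permutes:
  fixes n :: nat
  assumes "\<sigma> permutes {..<n}"
  shows "restrict x {..<n} \<circ> \<sigma> = restrict (\<lambda>i. x (\<sigma> i)) {..<n}"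
  using permutes_not_in[OF assms] permutes_lessThan[OF assms] by (auto simp: fun_eq_iff)

lemma tuple_comp_closed:
  assumes "\<sigma> permutes {..<n}" "x \<in> tuples R n"
  shows "x \<circ> \<sigma> \<in> tuples R n"
  using assms permutes_not_in[OF assms(1)] permutes_lessThan[OF assms(1)]
  by (auto simp: tuples_def PiE_def extensional_def)

lemma tuple_comp_hom:
  assumes "\<sigma> permutes {..<n}"
  shows "(\<lambda>x. x \<circ> \<sigma>) \<in> hom (tuple_monoid R n) (tuple_monoid R n)"
  by (rule homI)
    (simp_all add: tuple_monoid_simps tuple_comp_closed[OF assms] tuple_mult_def
      restrict_comp_permutes[OF assms])

lemma tensor_rels_cases [consumes 1, case_names add smult]:
  assumes "r \<in> tensor_rels A R n"
  obtains x i u v where "x \<in> tuples R n" "i < n" "u \<in> carrier R" "v \<in> carrier R"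
      "r = frag_of (x(i := u \<oplus>\<^bsub>R\<^esub> v)) - frag_of (x(i := u)) - frag_of (x(i := v))"
    | x i j a where "x \<in> tuples R n" "i < n" "j < n" "a \<in> carrier A"
      "r = frag_of (x(i := a \<odot>\<^bsub>R\<^esub> x i)) - frag_of (x(j := a \<odot>\<^bsub>R\<^esub> x j))"
  using assms unfolding tensor_rels_def by blast

lemma tensor_rels_addI:
  assumes "x \<in> tuples R n" "i < n" "u \<in> carrier R" "v \<in> carrier R"
  shows "frag_of (x(i := u \<oplus>\<^bsub>R\<^esub> v)) - frag_of (x(i := u)) - frag_of (x(i := v)) \<in> tensor_rels A R n"
  using assms unfolding tensor_rels_def by blast

lemma tensor_rels_smultI:
  assumes "x \<in> tuples R n" "i < n" "j < n" "a \<in> carrier A"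
  shows "frag_of (x(i := a \<odot>\<^bsub>R\<^esub> x i)) - frag_of (x(j := a \<odot>\<^bsub>R\<^esub> x j)) \<in> tensor_rels A R n"
  using assms unfolding tensor_rels_def by blast

locale algebra_tensor_power =
  fixes A :: "('a, 'k) ring_scheme" and R :: "('a, 'b, 'm) module_scheme" and n :: nat
  assumes algebra: "algebra A R" and pos: "0 < n"
begin

abbreviation "F \<equiv> monoid_ring (tuple_monoid R n)"
abbreviation "I \<equiv> tensor_ideal A R n"
abbreviation "T \<equiv> tensor_power A R n"
abbreviation "pure \<equiv> pure_tensor A R n"
abbreviation "\<phi> \<equiv> coproj A R n"

sublocale R: algebra A R
  by (rule algebra)

sublocale tuple_monoid: comm_monoid "tuple_monoid R n"
  by (rule R.comm_monoid_tuple_monoid)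

sublocale F: cring F
  by (rule tuple_monoid.cring_monoid_ring)

lemma frag_of_closed: "x \<in> tuples R n \<Longrightarrow> frag_of x \<in> carrier F"
  by (simp add: monoid_ring_closed tuple_monoid_simps)

lemma tensor_rels_subset: "tensor_rels A R n \<subseteq> carrier F"
proof
  fix r assume "r \<in> tensor_rels A R n"
  then show "r \<in> carrier F"
    by (cases rule: tensor_rels_cases)
      (auto intro!: monoid_ring_diff_closed frag_of_closed tuple_upd_closed R.smult_closed
        simp: tuple_closed)
qed

lemma tuple_mult_tensor_rel:
  assumes y: "y \<in> tuples R n" and "r \<in> tensor_rels A R n"
  shows "frag_of y \<otimes>\<^bsub>F\<^esub> r \<in> tensor_rels A R n"
  using assms(2)
proof (cases rule: tensor_rels_cases)
  case (add x i u v)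
  have "tuple_mult R n y x \<in> tuples R n"
    using tuple_monoid.m_closed[of y x] y add(1) by (simp add: tuple_monoid_simps)
  moreover have "y i \<in> carrier R" using y add(2) by (rule tuple_closed)
  ultimately show ?thesis
    using add tensor_rels_addI[of "tuple_mult R n y x" R n i "y i \<otimes>\<^bsub>R\<^esub> u" "y i \<otimes>\<^bsub>R\<^esub> v"]
    by (simp add: monoid_ring_mult_simps tuple_monoid_simps tuple_mult_upd R.r_distr)
next
  case (smult x i j a)
  let ?z = "tuple_mult R n y x"
  have z: "?z \<in> tuples R n"
    using tuple_monoid.m_closed[of y x] y smult(1) by (simp add: tuple_monoid_simps)
  have "y k \<otimes>\<^bsub>R\<^esub> (a \<odot>\<^bsub>R\<^esub> x k) = a \<odot>\<^bsub>R\<^esub> ?z k" if "k < n" for k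
    using that smult y R.smult_assoc2[of a "x k" "y k"]
    by (simp add: tuple_mult_def R.m_comm tuple_closed)
  then show ?thesis
    using smult tensor_rels_smultI[OF z smult(2-4)]
    by (simp add: monoid_ring_mult_simps tuple_monoid_simps tuple_mult_upd)
qed

lemma tensor_ideal_eq_generate: "I = generate (add_monoid F) (tensor_rels A R n)"
  by (simp add: tensor_ideal_def tuple_ring_eq_monoid_ring)

lemma tensor_rel_in_ideal: "r \<in> tensor_rels A R n \<Longrightarrow> r \<in> I"
  unfolding tensor_ideal_eq_generate by (rule generate.incl)

sublocale I: ideal I F
  unfolding tensor_ideal_eq_generate
  by (rule tuple_monoid.ideal_generate_monoid_ring[OF tensor_rels_subset])
    (simp add: tuple_monoid_simps tuple_mult_tensor_rel generate.incl)

lemma tensor_power_simps: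
  "carrier T = carrier (F Quot I)" "mult T = mult (F Quot I)" "one T = one (F Quot I)"
  "zero T = zero (F Quot I)" "add T = add (F Quot I)"
  by (simp_all add: tensor_power_def Let_def tuple_ring_eq_monoid_ring)

sublocale T: cring T
  using I.quotient_is_cring[OF F.is_cring] tensor_power_simps
  by (rule cring_if_same_operations)

abbreviation "cls \<equiv> a_r_coset F I"

sublocale cls: ring_hom_cring F T cls
  using I.rcos_ring_hom by unfold_locales (simp add: ring_hom_def tensor_power_simps)

lemma carrier_tensor_power: "carrier T = cls ` carrier F"
  unfolding tensor_power_simps FactRing_def A_RCOSETS_def' by auto

lemma cls_add: "c \<in> carrier F \<Longrightarrow> d \<in> carrier F \<Longrightarrow> cls (c + d) = cls c \<oplus>\<^bsub>T\<^esub> cls d"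
  using cls.hom_add by (simp add: monoid_ring_add)

lemma cls_diff: "c \<in> carrier F \<Longrightarrow> d \<in> carrier F \<Longrightarrow> cls (c - d) = cls c \<oplus>\<^bsub>T\<^esub> \<ominus>\<^bsub>T\<^esub> cls d"
  by (simp flip: tuple_monoid.monoid_ring_minus_eq_diff add: F.minus_eq)

lemma cls_eqI: "c \<in> carrier F \<Longrightarrow> d \<in> carrier F \<Longrightarrow> c - d \<in> I \<Longrightarrow> cls c = cls d"
  using F.quotient_eq_iff_same_a_r_cos[OF I.ideal_axioms, of c d]
  by (simp add: tuple_monoid.monoid_ring_minus_eq_diff)

lemma pure_eq_cls: "pure x = cls (frag_of (restrict x {..<n}))"
  by (simp add: pure_tensor_def tuple_ring_eq_monoid_ring)

lemma pure_closed [simp]: "x \<in> {..<n} \<rightarrow> carrier R \<Longrightarrow> pure x \<in> carrier T"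
  by (simp add: pure_eq_cls frag_of_closed restrict_in_tuples)

lemma pure_cong: "(\<And>i. i < n \<Longrightarrow> x i = y i) \<Longrightarrow> pure x = pure y"
  unfolding pure_eq_cls by (metis lessThan_iff restrict_ext)

lemma pure_mult:
  assumes "x \<in> {..<n} \<rightarrow> carrier R" "y \<in> {..<n} \<rightarrow> carrier R"
  shows "pure x \<otimes>\<^bsub>T\<^esub> pure y = pure (\<lambda>i. x i \<otimes>\<^bsub>R\<^esub> y i)"
proof -
  have "tuple_mult R n (restrict x {..<n}) (restrict y {..<n}) = (\<lambda>i\<in>{..<n}. x i \<otimes>\<^bsub>R\<^esub> y i)"
    by (auto simp: tuple_mult_def)
  then show ?thesis
    using assms cls.hom_mult[of "frag_of (restrict x {..<n})" "frag_of (restrict y {..<n})"]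
    by (simp add: pure_eq_cls frag_of_closed restrict_in_tuples monoid_ring_mult_of
        tuple_monoid_simps)
qed

lemma pure_one: "pure (\<lambda>_. \<one>\<^bsub>R\<^esub>) = \<one>\<^bsub>T\<^esub>"
  using cls.hom_one by (simp add: pure_eq_cls monoid_ring_one tuple_monoid_simps)

lemma pure_upd_eq_cls:
  "i < n \<Longrightarrow> pure (x(i := u)) = cls (frag_of ((restrict x {..<n})(i := u)))"
  unfolding pure_eq_cls by (rule arg_cong[where f = "\<lambda>y. cls (frag_of y)"]) auto

lemma pure_upd_add:
  assumes "x \<in> {..<n} \<rightarrow> carrier R" "i < n" "u \<in> carrier R" "v \<in> carrier R"
  shows "pure (x(i := u \<oplus>\<^bsub>R\<^esub> v)) = pure (x(i := u)) \<oplus>\<^bsub>T\<^esub> pure (x(i := v))"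
proof -
  let ?frag = "\<lambda>w. frag_of ((restrict x {..<n})(i := w))"
  have closed: "?frag w \<in> carrier F" if "w \<in> carrier R" for w
    using assms that by (intro frag_of_closed tuple_upd_closed restrict_in_tuples)
  have "?frag (u \<oplus>\<^bsub>R\<^esub> v) - ?frag u - ?frag v \<in> I"
    using assms by (intro tensor_rel_in_ideal tensor_rels_addI restrict_in_tuples)
  then have "cls (?frag (u \<oplus>\<^bsub>R\<^esub> v)) = cls (?frag u + ?frag v)"
    using assms closed F.a_closed[of "?frag u" "?frag v"]
    by (intro cls_eqI) (simp_all add: monoid_ring_add diff_diff_eq)
  then show ?thesis
    using assms closed by (simp add: pure_upd_eq_cls cls_add)
qed

lemma pure_upd_zero:
  assumes "x \<in> {..<n} \<rightarrow> carrier R" "i < n"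
  shows "pure (x(i := \<zero>\<^bsub>R\<^esub>)) = \<zero>\<^bsub>T\<^esub>"
proof -
  have closed: "pure (x(i := \<zero>\<^bsub>R\<^esub>)) \<in> carrier T" using assms by (intro pure_closed) auto
  have "pure (x(i := \<zero>\<^bsub>R\<^esub>)) \<oplus>\<^bsub>T\<^esub> pure (x(i := \<zero>\<^bsub>R\<^esub>)) = pure (x(i := \<zero>\<^bsub>R\<^esub>))"
    using pure_upd_add[OF assms R.zero_closed R.zero_closed] by simp
  then show ?thesis using closed by (metis T.add.r_cancel_one')
qed

lemma pure_upd_minus:
  assumes "x \<in> {..<n} \<rightarrow> carrier R" "i < n" "u \<in> carrier R"
  shows "pure (x(i := \<ominus>\<^bsub>R\<^esub> u)) = \<ominus>\<^bsub>T\<^esub> pure (x(i := u))"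
proof -
  have "pure (x(i := \<ominus>\<^bsub>R\<^esub> u)) \<oplus>\<^bsub>T\<^esub> pure (x(i := u)) = \<zero>\<^bsub>T\<^esub>"
    using pure_upd_add[of x i "\<ominus>\<^bsub>R\<^esub> u" u] pure_upd_zero assms by (simp add: R.l_neg)
  then show ?thesis
    using assms by (intro T.minus_equality[symmetric] pure_closed) auto
qed

text \<open>
  No case for differences is needed: as \<open>n \<ge> 1\<close>, the negative of a pure tensor is pure.
\<close>

lemma tensor_induct [consumes 1, case_names pure add]:
  assumes "t \<in> carrier T"
    and pure: "\<And>x. x \<in> {..<n} \<rightarrow> carrier R \<Longrightarrow> Q (pure x)"
    and add: "\<And>t u. t \<in> carrier T \<Longrightarrow> u \<in> carrier T \<Longrightarrow> Q t \<Longrightarrow> Q u \<Longrightarrow> Q (t \<oplus>\<^bsub>T\<^esub> u)"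
  shows "Q t"
proof -
  obtain c where c: "c \<in> carrier F" "t = cls c" using assms(1) by (auto simp: carrier_tensor_power)
  from c(1) have "c \<in> carrier F \<and> Q (cls c) \<and> Q (\<ominus>\<^bsub>T\<^esub> cls c)"
  proof (induction rule: monoid_ring_induct)
    case zero
    have "Q \<zero>\<^bsub>T\<^esub>"
      using pure[of "(\<lambda>_. \<one>\<^bsub>R\<^esub>)(0 := \<zero>\<^bsub>R\<^esub>)"] pure_upd_zero[of "\<lambda>_. \<one>\<^bsub>R\<^esub>" 0] pos by auto
    then show ?case using cls.hom_zero F.zero_closed by (simp add: monoid_ring_zero)
  next
    case (of x)
    then have x: "x \<in> tuples R n" by (simp add: tuple_monoid_simps)
    then have x_Pi: "x \<in> {..<n} \<rightarrow> carrier R" by (auto simp: tuples_def)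
    have "restrict x {..<n} = x" using x by (auto simp: tuples_def PiE_restrict)
    then have "pure x = cls (frag_of x)" by (simp add: pure_eq_cls)
    moreover have "\<ominus>\<^bsub>T\<^esub> pure x = pure (x(0 := \<ominus>\<^bsub>R\<^esub> x 0))"
      using pure_upd_minus[of x 0 "x 0"] x_Pi pos by auto
    moreover have "Q (pure (x(0 := \<ominus>\<^bsub>R\<^esub> x 0)))"
      using x_Pi pos by (intro pure) (simp add: Pi_iff)
    ultimately show ?case using x pure[OF x_Pi] by (simp add: frag_of_closed)
  next
    case (diff c d)
    then show ?case
      by (simp add: cls_diff monoid_ring_closed add T.minus_add)
  qed
  then show ?thesis using c by simp
qed

lemma coproj_eq_pure: "\<phi> p z = pure ((\<lambda>_. \<one>\<^bsub>R\<^esub>)(p := z))"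
  by (simp add: coproj_def fun_upd_def)

lemma coproj_closed [simp]: "z \<in> carrier R \<Longrightarrow> \<phi> p z \<in> carrier T"
  by (simp add: coproj_def)

lemma coproj_mult:
  assumes "z \<in> carrier R" "w \<in> carrier R"
  shows "\<phi> p z \<otimes>\<^bsub>T\<^esub> \<phi> p w = \<phi> p (z \<otimes>\<^bsub>R\<^esub> w)"
  unfolding coproj_def using assms by (simp add: pure_mult) (rule pure_cong, simp)

lemma coproj_ring_hom:
  assumes "p < n"
  shows "\<phi> p \<in> ring_hom R T"
proof (rule ring_hom_memI)
  fix z w assume "z \<in> carrier R" "w \<in> carrier R"
  then show "\<phi> p (z \<oplus>\<^bsub>R\<^esub> w) = \<phi> p z \<oplus>\<^bsub>T\<^esub> \<phi> p w"
    using pure_upd_add[of "\<lambda>_. \<one>\<^bsub>R\<^esub>" p z w] assms by (simp add: coproj_eq_pure)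
qed (simp_all add: coproj_mult, simp add: coproj_def pure_one)

lemma coproj_scalar:
  assumes "p < n" "q < n" "a \<in> carrier A"
  shows "\<phi> p (a \<odot>\<^bsub>R\<^esub> \<one>\<^bsub>R\<^esub>) = \<phi> q (a \<odot>\<^bsub>R\<^esub> \<one>\<^bsub>R\<^esub>)"
proof -
  let ?one = "\<lambda>i\<in>{..<n}. \<one>\<^bsub>R\<^esub>"
  let ?frag = "\<lambda>p. frag_of (?one(p := a \<odot>\<^bsub>R\<^esub> \<one>\<^bsub>R\<^esub>))"
  have one: "?one \<in> tuples R n" by (intro restrict_in_tuples) simp
  have "?frag p - ?frag q \<in> I"
    using tensor_rel_in_ideal[OF tensor_rels_smultI[OF one assms]] assms by simp
  then show ?thesis
    using assms one unfolding coproj_eq_pure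
    by (simp add: pure_upd_eq_cls cls_eqI frag_of_closed tuple_upd_closed del: restrict_apply)
qed

lemma pure_eq_finprod_coproj:
  assumes x: "x \<in> {..<n} \<rightarrow> carrier R"
  shows "pure x = (\<Otimes>\<^bsub>T\<^esub>p\<in>{..<n}. \<phi> p (x p))"
proof -
  let ?trunc = "\<lambda>m i. if i < m then x i else \<one>\<^bsub>R\<^esub>"
  have "pure (?trunc m) = (\<Otimes>\<^bsub>T\<^esub>p\<in>{..<m}. \<phi> p (x p))" if "m \<le> n" for m
    using that
  proof (induction m)
    case 0
    then show ?case by (simp add: pure_one)
  next
    case (Suc m)
    have "pure (?trunc (Suc m)) = \<phi> m (x m) \<otimes>\<^bsub>T\<^esub> pure (?trunc m)"
      unfolding coproj_def using x Suc.prems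
      by (simp add: pure_mult Pi_iff) (rule pure_cong, auto simp: less_Suc_eq)
    also have "\<dots> = (\<Otimes>\<^bsub>T\<^esub>p\<in>{..<Suc m}. \<phi> p (x p))"
      unfolding lessThan_Suc
      by (subst T.finprod_insert) (use Suc x in \<open>auto simp: Pi_iff\<close>)
    finally show ?case .
  qed
  from this[of n] show ?thesis by (simp add: pure_cong[of "?trunc n" x])
qed

lemma tensor_power_smult: "a \<odot>\<^bsub>T\<^esub> t = \<phi> 0 (a \<odot>\<^bsub>R\<^esub> \<one>\<^bsub>R\<^esub>) \<otimes>\<^bsub>T\<^esub> t"
  by (simp add: tensor_power_def Let_def)

lemma tensor_power_algebra: "algebra A T"
  using R.R_cring T.is_cring ring_hom_trans[OF R.scalar_ring_hom coproj_ring_hom[OF pos]]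
  by (rule algebra_if_smult_eq_hom_mult) (simp add: tensor_power_smult)

section \<open>Symmetric tensors and power sums\<close>

abbreviation "perms \<equiv> {\<sigma>. \<sigma> permutes {..<n}}"
abbreviation "permute \<sigma> \<equiv> frag_extend (\<lambda>x :: nat \<Rightarrow> 'b. frag_of (x \<circ> \<sigma>))"

lemma permute_ring_hom:
  assumes "\<sigma> permutes {..<n}"
  shows "permute \<sigma> \<in> ring_hom F F"
  by (rule monoid_ring_map_hom)
    (simp_all add: tuple_comp_hom[OF assms] tuple_monoid_simps restrict_comp_permutes[OF assms])

lemma permute_tensor_rel:
  assumes \<sigma>: "\<sigma> permutes {..<n}" and "r \<in> tensor_rels A R n"
  shows "permute \<sigma> r \<in> tensor_rels A R n"
proof -
  have upd: "x(\<sigma> j := u) \<circ> \<sigma> = (x \<circ> \<sigma>)(j := u)" for x :: "nat \<Rightarrow> 'b" and j u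
    using permutes_inj[OF \<sigma>] by (auto simp: fun_eq_iff inj_eq)
  have preimage: "\<exists>j<n. i = \<sigma> j" if "i < n" for i
    using permutes_image[OF \<sigma>] that by (auto simp: image_iff)
  from assms(2) show ?thesis
  proof (cases rule: tensor_rels_cases)
    case (add x i u v)
    obtain k where "k < n" "i = \<sigma> k" using preimage add by blast
    then show ?thesis
      using add tensor_rels_addI[OF tuple_comp_closed[OF \<sigma> add(1)], of k u v A]
      by (simp add: frag_extend_diff upd)
  next
    case (smult x i j a)
    obtain k l where "k < n" "i = \<sigma> k" "l < n" "j = \<sigma> l" using preimage smult by blast
    then show ?thesis
      using smult tensor_rels_smultI[OF tuple_comp_closed[OF \<sigma> smult(1)], of k l a A]
      by (simp add: frag_extend_diff upd)
  qed
qed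

lemma permute_inverse:
  assumes "\<sigma> permutes {..<n}"
  shows "permute \<sigma> (permute (inv_into UNIV \<sigma>) c) = c"
  using frag_extend_compose[of "\<lambda>x. frag_of (x \<circ> \<sigma>)" "\<lambda>x. x \<circ> inv_into UNIV \<sigma>" c]
  by (simp add: comp_def permutes_inverses[OF assms] flip: frag_expansion)

lemma permute_tensor_ideal:
  assumes "\<sigma> permutes {..<n}"
  shows "permute \<sigma> ` I = I"
proof -
  have sub: "permute \<tau> ` I \<subseteq> I" if "\<tau> permutes {..<n}" for \<tau>
  proof -
    interpret group_hom "add_monoid F" "add_monoid F" "permute \<tau>"
      using permute_ring_hom[OF that] by unfold_locales (simp add: ring_hom_def hom_def)
    have "permute \<tau> ` tensor_rels A R n \<subseteq> generate (add_monoid F) (tensor_rels A R n)"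
      using permute_tensor_rel[OF that] by (blast intro: generate.incl)
    then show ?thesis
      unfolding tensor_ideal_eq_generate
      by (rule generate_image_subset[rotated 2]) (simp_all add: tensor_rels_subset)
  qed
  show ?thesis
  proof (intro equalityI subsetI)
    fix c assume "c \<in> I"
    then have "permute (inv_into UNIV \<sigma>) c \<in> I" using sub[OF permutes_inv[OF assms]] by blast
    then show "c \<in> permute \<sigma> ` I" by (intro image_eqI) (simp_all only: permute_inverse[OF assms])
  next
    fix c assume "c \<in> permute \<sigma> ` I"
    then show "c \<in> I" using sub[OF assms] by (rule subsetD[rotated])
  qed
qed

lemma permute_factors_ring_hom:
  assumes "\<sigma> permutes {..<n}"
  shows "permute_factors \<sigma> \<in> ring_hom T T"
  using image_ring_hom_Quot[OF I.ideal_axioms I.ideal_axioms permute_ring_hom[OF assms]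
      permute_tensor_ideal[OF assms]]
  by (simp add: ring_hom_def tensor_power_simps permute_factors_def Pi_def)

lemma permute_factors_closed:
  "\<sigma> permutes {..<n} \<Longrightarrow> t \<in> carrier T \<Longrightarrow> permute_factors \<sigma> t \<in> carrier T"
  using ring_hom_closed[OF permute_factors_ring_hom] .

lemma permute_factors_pure:
  assumes \<sigma>: "\<sigma> permutes {..<n}" and x: "x \<in> {..<n} \<rightarrow> carrier R"
  shows "permute_factors \<sigma> (pure x) = pure (\<lambda>i. x (\<sigma> i))"
proof -
  have "permute_factors \<sigma> (pure x) = cls (permute \<sigma> (frag_of (restrict x {..<n})))"
    unfolding permute_factors_def pure_eq_cls
    using F.image_a_r_coset[OF permute_ring_hom[OF \<sigma>] I.a_subset] x permute_tensor_ideal[OF \<sigma>]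
    by (simp add: frag_of_closed restrict_in_tuples)
  then show ?thesis by (simp add: pure_eq_cls restrict_comp_permutes[OF \<sigma>])
qed

lemma permute_factors_coproj:
  assumes \<sigma>: "\<sigma> permutes {..<n}" and "z \<in> carrier R"
  shows "permute_factors \<sigma> (\<phi> (\<sigma> p) z) = \<phi> p z"
  using permutes_inj[OF \<sigma>] assms by (simp add: coproj_def permute_factors_pure inj_eq)

lemma permute_factors_smult:
  assumes \<sigma>: "\<sigma> permutes {..<n}" and "a \<in> carrier A" "t \<in> carrier T"
  shows "permute_factors \<sigma> (a \<odot>\<^bsub>T\<^esub> t) = a \<odot>\<^bsub>T\<^esub> permute_factors \<sigma> t"
proof -
  let ?scalar = "\<lambda>p. \<phi> p (a \<odot>\<^bsub>R\<^esub> \<one>\<^bsub>R\<^esub>)"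
  have "permute_factors \<sigma> (?scalar 0) = permute_factors \<sigma> (?scalar (\<sigma> 0))"
    using coproj_scalar[OF pos permutes_lessThan[OF \<sigma> pos] assms(2)] by simp
  then have "permute_factors \<sigma> (?scalar 0) = ?scalar 0"
    using permute_factors_coproj[OF \<sigma>] assms(2) by simp
  then show ?thesis
    using ring_hom_mult[OF permute_factors_ring_hom[OF \<sigma>], of "?scalar 0" t] assms
    by (simp add: tensor_power_smult)
qed

abbreviation "TS \<equiv> sym_tensors A R n"

lemma mem_carrier_sym_tensors:
  "t \<in> carrier TS \<longleftrightarrow> t \<in> carrier T \<and> (\<forall>\<sigma>. \<sigma> permutes {..<n} \<longrightarrow> permute_factors \<sigma> t = t)"
  by (simp add: sym_tensors_def)

lemma sym_tensors_eq: "TS = T\<lparr>carrier := carrier TS\<rparr>"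
  by (simp add: sym_tensors_def)

lemma is_subalgebra_sym_tensors: "is_subalgebra A T (carrier TS)"
proof -
  interpret T: algebra A T by (rule tensor_power_algebra)
  have fixed: "carrier TS = {t \<in> carrier T. \<forall>h\<in>permute_factors ` perms. h t = t}"
    by (auto simp: mem_carrier_sym_tensors)
  show ?thesis
    unfolding fixed
    by (rule T.is_subalgebra_fixed_points)
      (auto simp: permute_factors_ring_hom permute_factors_smult)
qed

lemma sym_tensors_algebra: "algebra A TS"
  using algebra.algebra_subalgebra[OF tensor_power_algebra is_subalgebra_sym_tensors]
  by (simp flip: sym_tensors_eq)

lemma power_sum_in_sym_tensors:
  assumes z: "z \<in> carrier R"
  shows "power_sum A R n z \<in> carrier TS"
  unfolding mem_carrier_sym_tensors
proof (intro conjI allI impI)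
  show "power_sum A R n z \<in> carrier T"
    unfolding power_sum_def using z by (intro T.finsum_closed) simp
  fix \<sigma> assume \<sigma>: "\<sigma> permutes {..<n}"
  interpret h: ring_hom_cring T T "permute_factors \<sigma>"
    by unfold_locales (rule permute_factors_ring_hom[OF \<sigma>])
  have "permute_factors \<sigma> (power_sum A R n z) = permute_factors \<sigma> (\<Oplus>\<^bsub>T\<^esub>p\<in>{..<n}. \<phi> (\<sigma> p) z)"
    using T.add.finprod_permute[OF \<sigma>, of "\<lambda>p. \<phi> p z"] z by (simp add: power_sum_def)
  also have "\<dots> = (\<Oplus>\<^bsub>T\<^esub>p\<in>{..<n}. permute_factors \<sigma> (\<phi> (\<sigma> p) z))"
    using z by (subst h.hom_finsum) (simp_all add: comp_def)
  also have "\<dots> = power_sum A R n z"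
    by (simp add: permute_factors_coproj[OF \<sigma> z] power_sum_def)
  finally show "permute_factors \<sigma> (power_sum A R n z) = power_sum A R n z" .
qed

abbreviation "P \<equiv> carrier (power_sum_algebra A R n)"

lemma power_sum_algebra_eq: "power_sum_algebra A R n = TS\<lparr>carrier := P\<rparr>"
  by (simp add: power_sum_algebra_def generated_subalgebra_def)

lemma is_subalgebra_power_sum_algebra: "is_subalgebra A TS P"
  unfolding power_sum_algebra_def
  using power_sum_in_sym_tensors
  by (intro algebra.is_subalgebra_generated[OF sym_tensors_algebra]) auto

lemma power_sum_algebra_algebra: "algebra A (power_sum_algebra A R n)"
  using algebra.algebra_subalgebra[OF sym_tensors_algebra is_subalgebra_power_sum_algebra]
  by (simp flip: power_sum_algebra_eq)

lemma power_sum_algebra_subset: "P \<subseteq> carrier TS"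
  using is_subalgebra_power_sum_algebra subringE(1) unfolding is_subalgebra_def by blast

lemma subring_power_sum_algebra: "subring P T"
proof (rule T.ring_incl_imp_subring)
  show "P \<subseteq> carrier T"
    using power_sum_algebra_subset by (auto simp: mem_carrier_sym_tensors)
  have "power_sum_algebra A R n = T\<lparr>carrier := P\<rparr>"
    by (simp add: power_sum_algebra_def generated_subalgebra_def sym_tensors_def)
  then show "ring (T\<lparr>carrier := P\<rparr>)"
    using algebra.M_cring[OF power_sum_algebra_algebra] by (simp add: cring_def)
qed

lemma power_sum_in_power_sum_algebra:
  assumes "z \<in> carrier R"
  shows "power_sum A R n z \<in> P"
  unfolding power_sum_algebra_def
  by (rule subsetD[OF generated_subalgebra_superset]) (use assms in simp)

section \<open>Alternating tensors\<close>

lemma alt_tensor_eq_det: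
  assumes x: "x \<in> {..<n} \<rightarrow> carrier R"
  shows "alt_tensor A R n x = T.det {..<n} (\<lambda>p i. \<phi> p (x i))"
proof -
  have "pure (\<lambda>i. x (\<sigma> i)) = (\<Otimes>\<^bsub>T\<^esub>p\<in>{..<n}. \<phi> p (x (\<sigma> p)))" "pure (\<lambda>i. x (\<sigma> i)) \<in> carrier T"
    if "\<sigma> permutes {..<n}" for \<sigma>
    using x permutes_lessThan[OF that] by (auto intro!: pure_eq_finprod_coproj pure_closed)
  then show ?thesis
    unfolding alt_tensor_def T.det_def by (intro T.finsum_cong') auto
qed

lemma alt_tensor_closed:
  assumes "x \<in> {..<n} \<rightarrow> carrier R"
  shows "alt_tensor A R n x \<in> carrier T"
  unfolding alt_tensor_eq_det[OF assms] using assms by (intro T.det_closed) (simp add: Pi_iff)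

lemma alt_tensor_mult_eq_det_power_sum:
  assumes x: "x \<in> {..<n} \<rightarrow> carrier R" and y: "y \<in> {..<n} \<rightarrow> carrier R"
  shows "alt_tensor A R n x \<otimes>\<^bsub>T\<^esub> alt_tensor A R n y =
    T.det {..<n} (\<lambda>i j. power_sum A R n (x i \<otimes>\<^bsub>R\<^esub> y j))"
proof -
  have "alt_tensor A R n x \<otimes>\<^bsub>T\<^esub> alt_tensor A R n y =
      T.det {..<n} (\<lambda>i p. \<phi> p (x i)) \<otimes>\<^bsub>T\<^esub> T.det {..<n} (\<lambda>p j. \<phi> p (y j))"
    using x T.det_transpose[of "{..<n}" "\<lambda>p i. \<phi> p (x i)"]
    by (simp add: alt_tensor_eq_det[OF x] alt_tensor_eq_det[OF y] Pi_iff)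
  also have "\<dots> = T.det {..<n} (\<lambda>i j. \<Oplus>\<^bsub>T\<^esub>p\<in>{..<n}. \<phi> p (x i) \<otimes>\<^bsub>T\<^esub> \<phi> p (y j))"
    using x y by (intro T.det_mult[symmetric]) (simp_all add: Pi_iff)
  also have "\<dots> = T.det {..<n} (\<lambda>i j. power_sum A R n (x i \<otimes>\<^bsub>R\<^esub> y j))"
  proof (rule T.det_cong)
    fix i j assume "i \<in> {..<n}" "j \<in> {..<n}"
    then have "x i \<in> carrier R" "y j \<in> carrier R" using x y by auto
    then show "(\<Oplus>\<^bsub>T\<^esub>p\<in>{..<n}. \<phi> p (x i) \<otimes>\<^bsub>T\<^esub> \<phi> p (y j)) = power_sum A R n (x i \<otimes>\<^bsub>R\<^esub> y j)"
      by (simp add: coproj_mult power_sum_def)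
    show "power_sum A R n (x i \<otimes>\<^bsub>R\<^esub> y j) \<in> carrier T"
      using \<open>x i \<in> carrier R\<close> \<open>y j \<in> carrier R\<close> power_sum_in_sym_tensors[of "x i \<otimes>\<^bsub>R\<^esub> y j"]
      by (simp add: mem_carrier_sym_tensors)
  qed
  finally show ?thesis .
qed

lemma alt_tensor_mult_in_power_sum_algebra:
  assumes "x \<in> {..<n} \<rightarrow> carrier R" "y \<in> {..<n} \<rightarrow> carrier R"
  shows "alt_tensor A R n x \<otimes>\<^bsub>T\<^esub> alt_tensor A R n y \<in> P"
  unfolding alt_tensor_mult_eq_det_power_sum[OF assms]
  using assms
  by (intro T.det_in_subring[OF subring_power_sum_algebra] power_sum_in_power_sum_algebra) auto

definition alternator :: "((nat \<Rightarrow> 'b) \<Rightarrow>\<^sub>0 int) set \<Rightarrow> ((nat \<Rightarrow> 'b) \<Rightarrow>\<^sub>0 int) set"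
  where "alternator t = (\<Oplus>\<^bsub>T\<^esub>\<sigma>\<in>perms. [sign \<sigma>] \<cdot>\<^bsub>T\<^esub> permute_factors \<sigma> t)"

lemma alternator_closed: "t \<in> carrier T \<Longrightarrow> alternator t \<in> carrier T"
  unfolding alternator_def using permute_factors_closed by (intro T.finsum_closed) auto

lemma alternator_pure:
  assumes x: "x \<in> {..<n} \<rightarrow> carrier R"
  shows "alternator (pure x) = alt_tensor A R n x"
  unfolding alternator_def alt_tensor_def
  by (rule T.finsum_cong')
    (use x in \<open>auto simp: permute_factors_pure Pi_iff permutes_lessThan intro!: pure_closed\<close>)

lemma alternator_add:
  assumes "t \<in> carrier T" "u \<in> carrier T"
  shows "alternator (t \<oplus>\<^bsub>T\<^esub> u) = alternator t \<oplus>\<^bsub>T\<^esub> alternator u"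
proof -
  have "alternator (t \<oplus>\<^bsub>T\<^esub> u) =
      (\<Oplus>\<^bsub>T\<^esub>\<sigma>\<in>perms. [sign \<sigma>] \<cdot>\<^bsub>T\<^esub> permute_factors \<sigma> t \<oplus>\<^bsub>T\<^esub> [sign \<sigma>] \<cdot>\<^bsub>T\<^esub> permute_factors \<sigma> u)"
    unfolding alternator_def
    by (rule T.finsum_cong') (use assms permute_factors_closed in
      \<open>auto simp: ring_hom_add[OF permute_factors_ring_hom] T.add.int_pow_distrib\<close>)
  also have "\<dots> = alternator t \<oplus>\<^bsub>T\<^esub> alternator u"
    unfolding alternator_def
    by (rule T.finsum_addf) (use assms permute_factors_closed in auto)
  finally show ?thesis .
qed

lemma alternator_mult_sym:
  assumes u: "u \<in> carrier T" and t: "t \<in> carrier TS"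
  shows "alternator (u \<otimes>\<^bsub>T\<^esub> t) = alternator u \<otimes>\<^bsub>T\<^esub> t"
proof -
  have tT: "t \<in> carrier T" using t by (simp add: mem_carrier_sym_tensors)
  have "alternator u \<otimes>\<^bsub>T\<^esub> t = (\<Oplus>\<^bsub>T\<^esub>\<sigma>\<in>perms. ([sign \<sigma>] \<cdot>\<^bsub>T\<^esub> permute_factors \<sigma> u) \<otimes>\<^bsub>T\<^esub> t)"
    unfolding alternator_def
    by (rule T.finsum_ldistr) (use u tT permute_factors_closed in \<open>auto simp: finite_permutations\<close>)
  also have "\<dots> = alternator (u \<otimes>\<^bsub>T\<^esub> t)"
    unfolding alternator_def
  proof (rule T.finsum_cong'[OF refl])
    fix \<sigma> assume "\<sigma> \<in> perms"
    then have \<sigma>: "\<sigma> permutes {..<n}" by simp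
    then have "permute_factors \<sigma> (u \<otimes>\<^bsub>T\<^esub> t) = permute_factors \<sigma> u \<otimes>\<^bsub>T\<^esub> t"
      using ring_hom_mult[OF permute_factors_ring_hom[OF \<sigma>] u tT] t
      by (simp add: mem_carrier_sym_tensors)
    then show "([sign \<sigma>] \<cdot>\<^bsub>T\<^esub> permute_factors \<sigma> u) \<otimes>\<^bsub>T\<^esub> t =
        [sign \<sigma>] \<cdot>\<^bsub>T\<^esub> permute_factors \<sigma> (u \<otimes>\<^bsub>T\<^esub> t)"
      using u tT permute_factors_closed[OF \<sigma>] by (simp add: T.add_pow_ldistr_int)
  qed (use u tT permute_factors_closed in auto)
  finally show ?thesis ..
qed

lemma alt_tensor_mult_alternator_in_power_sum_algebra:
  assumes x: "x \<in> {..<n} \<rightarrow> carrier R" and "t \<in> carrier T"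
  shows "alt_tensor A R n x \<otimes>\<^bsub>T\<^esub> alternator t \<in> P"
  using assms(2)
proof (induction rule: tensor_induct)
  case (pure y)
  then show ?case using x by (simp add: alternator_pure alt_tensor_mult_in_power_sum_algebra)
next
  case (add t u)
  then show ?case
    using subringE(7)[OF subring_power_sum_algebra] alt_tensor_closed[OF x]
    by (simp add: alternator_add alternator_closed T.r_distr)
qed

lemma alt_tensor_sq_in_power_sum_algebra:
  "x \<in> {..<n} \<rightarrow> carrier R \<Longrightarrow> alt_tensor_sq A R n x \<in> P"
  by (simp add: alt_tensor_sq_def alt_tensor_mult_in_power_sum_algebra)

lemma alt_tensor_sq_mult_in_power_sum_algebra:
  assumes x: "x \<in> {..<n} \<rightarrow> carrier R" and t: "t \<in> carrier TS"
  shows "alt_tensor_sq A R n x \<otimes>\<^bsub>T\<^esub> t \<in> P"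
proof -
  have tT: "t \<in> carrier T" using t by (simp add: mem_carrier_sym_tensors)
  have "alt_tensor_sq A R n x \<otimes>\<^bsub>T\<^esub> t = alt_tensor A R n x \<otimes>\<^bsub>T\<^esub> (alternator (pure x) \<otimes>\<^bsub>T\<^esub> t)"
    using alt_tensor_closed[OF x] tT by (simp add: alt_tensor_sq_def alternator_pure[OF x] T.m_assoc)
  also have "\<dots> = alt_tensor A R n x \<otimes>\<^bsub>T\<^esub> alternator (pure x \<otimes>\<^bsub>T\<^esub> t)"
    using x t by (simp add: alternator_mult_sym)
  also have "\<dots> \<in> P"
    using x tT by (intro alt_tensor_mult_alternator_in_power_sum_algebra) simp_all
  finally show ?thesis .
qed

end

theorem proposition3p7:
  fixes A :: "('a, 'k) ring_scheme"
    and R :: "('a, 'b, 'm) module_scheme"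
    and n :: nat
    and x :: "nat \<Rightarrow> 'b"
  assumes "algebra A R"
    and "n \<ge> 1"
    and "\<And>i. i < n \<Longrightarrow> x i \<in> carrier R"
  shows "alt_tensor_sq A R n x \<in> carrier (power_sum_algebra A R n) \<and>
    localization_map (\<lambda>t. t) (sym_tensors A R n) (alt_tensor_sq A R n x)
      \<in> algebra_iso A
          (localization (power_sum_algebra A R n) (alt_tensor_sq A R n x))
          (localization (sym_tensors A R n) (alt_tensor_sq A R n x))"
proof -
  interpret algebra_tensor_power A R n
    using assms(1,2) by (intro algebra_tensor_power.intro) simp_all
  have x: "x \<in> {..<n} \<rightarrow> carrier R" using assms(3) by simp
  have \<alpha>_sq: "alt_tensor_sq A R n x \<in> P" using x by (rule alt_tensor_sq_in_power_sum_algebra)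
  moreover have "localization_map (\<lambda>t. t) TS (alt_tensor_sq A R n x)
      \<in> algebra_iso A (localization (TS\<lparr>carrier := P\<rparr>) (alt_tensor_sq A R n x))
          (localization TS (alt_tensor_sq A R n x))"
    using sym_tensors_algebra is_subalgebra_power_sum_algebra \<alpha>_sq
  proof (rule localization_map_subalgebra_iso)
    fix t assume "t \<in> carrier TS"
    then show "alt_tensor_sq A R n x \<otimes>\<^bsub>TS\<^esub> t \<in> P"
      using alt_tensor_sq_mult_in_power_sum_algebra[OF x] by (simp add: sym_tensors_def)
  qed
  ultimately show ?thesis by (simp flip: power_sum_algebra_eq)
qed

end
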